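(* Let $G$ be a (countable) discrete weakly amenable group and let $J\subseteq L^1(G)$ be a closed left ideal. Then $$(\operatorname{Ran} J)^{\perp} = \operatorname{Bim}(J^{\perp}).$$
   Context: Notation (for a second countable locally compact group $G$ with left Haar measure and modular function $\Delta$; for discrete $G$ this is counting measure and $\Delta=1$). $\lambda,\rho$ are the left and right regular representations on $L^2(G)$: $(\lambda_s f)(t)=f(s^{-1}t)$, $(\rho_r f)(s)=\Delta(r)^{1/2}f(sr)$. $\operatorname{VN}(G)$ is the weak-* closed linear span of $\{\lambda_x:x\in G\}$ in $\mathcal B(L^2(G))$. $M_a$ is multiplication by $a\in L^\infty(G)$ on $L^2(G)$. $\mathcal T(G)$ is the predual of $\mathcal B(L^2(G))$ (the trace class with trace norm $\|\cdot\|_t$), identified with functions $h(x,y)=\sum_i f_i(x)g_i(y)$, $\sum_i\|f_i\|_2^2<\infty$, $\sum_i\|g_i\|_2^2<\infty$, with pairing $\langle T,h\rangle_t=\sum_i (Tf_i,\overline{g_i})$. $M(G)$ is the convolution algebra of bounded complex Borel measures; $L^1(G)$ is identified with the absolutely continuous ones. For $\mu\in M(G)$, $\Theta(\mu):\mathcal B(L^2(G))\to\mathcal B(L^2(G))$ is the bounded weak-* continuous map $\langle\Theta(\mu)(T),h\rangle_t=\int_G\langle \rho_rT\rho_r^*,h\rangle_t\,d\mu(r)$, $h\in\mathcal T(G)$, and $\theta(\mu):\mathcal T(G)\to\mathcal T(G)$ is its predual. For a closed left ideal $J\subseteq L^1(G)$: $J^\perp=\{a\in L^\infty(G):\int_G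 af=0\ \forall f\in J\}$; $\operatorname{Ran}J$ is the $\|\cdot\|_t$-closed linear span of $\{\theta(f)(h): f\in J,\ h\in\mathcal T(G)\}$ in $\mathcal T(G)$; $(\operatorname{Ran}J)^\perp$ is its annihilator in $\mathcal B(L^2(G))$. For a subspace $\mathcal U\subseteq L^\infty(G)$, $\operatorname{Bim}(\mathcal U)$ is the weak-* closed linear span of $\{AM_aB: A,B\in\operatorname{VN}(G),\ a\in\mathcal U\}$ in $\mathcal B(L^2(G))$. Weak amenability of a discrete group $G$: there are a net $\{u_i\}$ of finitely supported functions in the Fourier algebra $A(G)$ (the predual of $\operatorname{VN}(G)$) and a constant $L>0$ such that $\|u_i\|_{mcb}\le L$ for all $i$ and $u_i(s)\to1$ for every $s\in G$. Here $\|u\|_{mcb}$ is the completely bounded norm of $u$ as a multiplier of $A(G)$, i.e. the completely bounded norm of the dual $m_u^*:\operatorname{VN}(G)\to\operatorname{VN}(G)$ of the map $m_u(v)=uv$ on $A(G)$ (so $m_u^*(\lambda_x)=u(x)\lambda_x$); equivalently the norm of the Schur multiplier with symbol $N(u)(s,t)=u(ts^{-1})$. *)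

theory Defs
  imports "HOL-Analysis.Analysis" "HOL-Library.Function_Algebras"
begin

text \<open>
  A discrete group is a type of class \<open>group_add\<close>, whose addition need not be commutative:
  \<open>s + t\<close> is the product \<open>st\<close>, \<open>- s\<close> is the inverse of \<open>s\<close>, and \<open>0\<close> is the identity.
  Haar measure is counting measure and the modular function is 1.
\<close>

section \<open>The complex Hilbert space \<open>L\<^sup>2\<close>\<close>

typedef 'a l2 = "{f :: 'a \<Rightarrow> complex. (\<lambda>x. (cmod (f x))\<^sup>2) summable_on UNIV}"
  morphisms l2_fun Abs_l2
  by (rule exI[of _ "\<lambda>_. 0"]) simp

setup_lifting type_definition_l2

lemma l2_summable: "(\<lambda>x. (cmod (l2_fun \<xi> x))\<^sup>2) summable_on UNIV"
  using l2_fun by blast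

lemma l2_eqI: "(\<And>x. l2_fun \<xi> x = l2_fun \<eta> x) \<Longrightarrow> \<xi> = \<eta>"
  by (metis l2_fun_inject ext)

lemma l2_add_closed:
  fixes f g :: "'a \<Rightarrow> complex"
  assumes f: "(\<lambda>x. (cmod (f x))\<^sup>2) summable_on UNIV"
    and g: "(\<lambda>x. (cmod (g x))\<^sup>2) summable_on UNIV"
  shows "(\<lambda>x. (cmod (f x + g x))\<^sup>2) summable_on UNIV"
proof (rule summable_on_comparison_test)
  show "(\<lambda>x. 2 * (cmod (f x))\<^sup>2 + 2 * (cmod (g x))\<^sup>2) summable_on UNIV"
    by (intro summable_on_add summable_on_cmult_right f g)
  show "(cmod (f x + g x))\<^sup>2 \<le> 2 * (cmod (f x))\<^sup>2 + 2 * (cmod (g x))\<^sup>2" for x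
  proof -
    have "(cmod (f x + g x))\<^sup>2 \<le> (cmod (f x) + cmod (g x))\<^sup>2"
      by (simp add: norm_triangle_ineq power_mono)
    also have "\<dots> \<le> 2 * (cmod (f x))\<^sup>2 + 2 * (cmod (g x))\<^sup>2"
      using sum_squares_bound[of "cmod (f x)" "cmod (g x)"]
      by (simp add: power2_sum)
    finally show ?thesis .
  qed
qed simp

lemma l2_scale_closed:
  fixes f :: "'a \<Rightarrow> complex"
  assumes "(\<lambda>x. (cmod (f x))\<^sup>2) summable_on UNIV"
  shows "(\<lambda>x. (cmod (c * f x))\<^sup>2) summable_on UNIV"
  using summable_on_cmult_right[OF assms, of "(cmod c)\<^sup>2"]
  by (simp add: norm_mult power_mult_distrib)

lemma l2_prod_abs_summable:
  fixes f g :: "'a \<Rightarrow> complex"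
  assumes f: "(\<lambda>x. (cmod (f x))\<^sup>2) summable_on UNIV"
    and g: "(\<lambda>x. (cmod (g x))\<^sup>2) summable_on UNIV"
  shows "(\<lambda>x. norm (f x * g x)) summable_on UNIV"
proof (rule summable_on_comparison_test)
  show "(\<lambda>x. (cmod (f x))\<^sup>2 + (cmod (g x))\<^sup>2) summable_on UNIV"
    by (intro summable_on_add f g)
  show "norm (f x * g x) \<le> (cmod (f x))\<^sup>2 + (cmod (g x))\<^sup>2" for x
  proof -
    have "2 * (cmod (f x) * cmod (g x)) \<le> (cmod (f x))\<^sup>2 + (cmod (g x))\<^sup>2"
      using sum_squares_bound[of "cmod (f x)" "cmod (g x)"] by (simp add: mult.assoc)
    moreover have "0 \<le> cmod (f x) * cmod (g x)" by simp
    ultimately show ?thesis unfolding norm_mult by linarith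
  qed
qed simp

lift_definition l2_scaleC :: "complex \<Rightarrow> 'a l2 \<Rightarrow> 'a l2" (infixr "*\<^sub>C" 75)
  is "\<lambda>c f x. c * f x"
  using l2_scale_closed by blast

lift_definition l2_cnj :: "'a l2 \<Rightarrow> 'a l2"
  is "\<lambda>f x. cnj (f x)"
  by simp

definition cinner :: "'a l2 \<Rightarrow> 'a l2 \<Rightarrow> complex" where
  "cinner \<xi> \<eta> = (\<Sum>\<^sub>\<infinity>x. l2_fun \<xi> x * cnj (l2_fun \<eta> x))"

lemma cinner_summable: "(\<lambda>x. l2_fun \<xi> x * cnj (l2_fun \<eta> x)) summable_on UNIV"
  by (rule abs_summable_summable, rule l2_prod_abs_summable) (simp_all add: l2_summable)

instantiation l2 :: (type) real_inner
begin

lift_definition zero_l2 :: "'a l2" is "\<lambda>_. 0" by simp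

lift_definition plus_l2 :: "'a l2 \<Rightarrow> 'a l2 \<Rightarrow> 'a l2" is "\<lambda>f g x. f x + g x"
  using l2_add_closed by blast

lift_definition uminus_l2 :: "'a l2 \<Rightarrow> 'a l2" is "\<lambda>f x. - f x" by simp

definition minus_l2 :: "'a l2 \<Rightarrow> 'a l2 \<Rightarrow> 'a l2" where
  "minus_l2 \<xi> \<eta> = \<xi> + (- \<eta>)"

definition scaleR_l2 :: "real \<Rightarrow> 'a l2 \<Rightarrow> 'a l2" where
  "scaleR_l2 r \<xi> = complex_of_real r *\<^sub>C \<xi>"

definition inner_l2 :: "'a l2 \<Rightarrow> 'a l2 \<Rightarrow> real" where
  "inner_l2 \<xi> \<eta> = Re (cinner \<xi> \<eta>)"

definition norm_l2 :: "'a l2 \<Rightarrow> real" where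
  "norm_l2 \<xi> = sqrt (\<Sum>\<^sub>\<infinity>x. (cmod (l2_fun \<xi> x))\<^sup>2)"

definition sgn_l2 :: "'a l2 \<Rightarrow> 'a l2" where
  "sgn_l2 \<xi> = inverse (norm \<xi>) *\<^sub>R \<xi>"

definition dist_l2 :: "'a l2 \<Rightarrow> 'a l2 \<Rightarrow> real" where
  "dist_l2 \<xi> \<eta> = norm (\<xi> - \<eta>)"

definition uniformity_l2 :: "('a l2 \<times> 'a l2) filter" where
  "uniformity_l2 = (INF e\<in>{0<..}. principal {(\<xi>, \<eta>). dist \<xi> \<eta> < e})"

definition open_l2 :: "'a l2 set \<Rightarrow> bool" where
  "open_l2 U = (\<forall>\<xi>\<in>U. eventually (\<lambda>(\<xi>', \<eta>). \<xi>' = \<xi> \<longrightarrow> \<eta> \<in> U) uniformity)"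

lemmas l2_fun_simps = zero_l2.rep_eq plus_l2.rep_eq uminus_l2.rep_eq l2_scaleC.rep_eq

lemma cinner_self: "cinner \<xi> \<xi> = complex_of_real (\<Sum>\<^sub>\<infinity>x. (cmod (l2_fun \<xi> x))\<^sup>2)"
proof -
  have "cinner \<xi> \<xi> = (\<Sum>\<^sub>\<infinity>x. complex_of_real ((cmod (l2_fun \<xi> x))\<^sup>2))"
    unfolding cinner_def by (rule infsum_cong) (simp only: complex_norm_square)
  also have "\<dots> = complex_of_real (\<Sum>\<^sub>\<infinity>x. (cmod (l2_fun \<xi> x))\<^sup>2)"
    by (intro infsumI has_sum_of_real has_sum_infsum l2_summable)
  finally show ?thesis .
qed

instance
proof
  fix \<xi> \<eta> \<zeta> :: "'a l2" and r s :: real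
  show "\<xi> + \<eta> + \<zeta> = \<xi> + (\<eta> + \<zeta>)" by (rule l2_eqI) (simp add: l2_fun_simps)
  show "\<xi> + \<eta> = \<eta> + \<xi>" by (rule l2_eqI) (simp add: l2_fun_simps)
  show "0 + \<xi> = \<xi>" by (rule l2_eqI) (simp add: l2_fun_simps)
  show "- \<xi> + \<xi> = 0" by (rule l2_eqI) (simp add: l2_fun_simps)
  show "\<xi> - \<eta> = \<xi> + - \<eta>" by (rule minus_l2_def)
  show "r *\<^sub>R (\<xi> + \<eta>) = r *\<^sub>R \<xi> + r *\<^sub>R \<eta>"
    by (rule l2_eqI) (simp add: l2_fun_simps scaleR_l2_def algebra_simps)
  show "(r + s) *\<^sub>R \<xi> = r *\<^sub>R \<xi> + s *\<^sub>R \<xi>"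
    by (rule l2_eqI) (simp add: l2_fun_simps scaleR_l2_def algebra_simps)
  show "r *\<^sub>R s *\<^sub>R \<xi> = (r * s) *\<^sub>R \<xi>"
    by (rule l2_eqI) (simp add: l2_fun_simps scaleR_l2_def)
  show "1 *\<^sub>R \<xi> = \<xi>"
    by (rule l2_eqI) (simp add: l2_fun_simps scaleR_l2_def)
  show "dist \<xi> \<eta> = norm (\<xi> - \<eta>)" by (rule dist_l2_def)
  show "sgn \<xi> = inverse (norm \<xi>) *\<^sub>R \<xi>" by (rule sgn_l2_def)
  have "cinner \<eta> \<xi> = cnj (cinner \<xi> \<eta>)"
    unfolding cinner_def infsum_cnj[symmetric] by (rule infsum_cong) simp
  then show "\<xi> \<bullet> \<eta> = \<eta> \<bullet> \<xi>" by (simp add: inner_l2_def)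
  have "cinner (\<xi> + \<eta>) \<zeta> = cinner \<xi> \<zeta> + cinner \<eta> \<zeta>"
    unfolding cinner_def
    by (simp add: l2_fun_simps ring_distribs infsum_add cinner_summable)
  then show "(\<xi> + \<eta>) \<bullet> \<zeta> = \<xi> \<bullet> \<zeta> + \<eta> \<bullet> \<zeta>" by (simp add: inner_l2_def)
  have "cinner (complex_of_real r *\<^sub>C \<xi>) \<eta> = complex_of_real r * cinner \<xi> \<eta>"
    unfolding cinner_def
    by (simp add: l2_fun_simps mult.assoc infsum_cmult_right cinner_summable)
  then show "(r *\<^sub>R \<xi>) \<bullet> \<eta> = r * (\<xi> \<bullet> \<eta>)"
    by (simp add: inner_l2_def scaleR_l2_def)
  have pos: "0 \<le> (\<Sum>\<^sub>\<infinity>x. (cmod (l2_fun \<xi> x))\<^sup>2)" by (rule infsum_nonneg) simp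
  show "0 \<le> \<xi> \<bullet> \<xi>" using pos by (simp add: inner_l2_def cinner_self)
  show "norm \<xi> = sqrt (\<xi> \<bullet> \<xi>)" by (simp add: norm_l2_def inner_l2_def cinner_self)
  show "(\<xi> \<bullet> \<xi> = 0) = (\<xi> = 0)"
  proof
    assume "\<xi> \<bullet> \<xi> = 0"
    then have "(\<Sum>\<^sub>\<infinity>x. (cmod (l2_fun \<xi> x))\<^sup>2) \<le> 0" by (simp add: inner_l2_def cinner_self)
    then have "(cmod (l2_fun \<xi> x))\<^sup>2 = 0" for x
      by (rule nonneg_infsum_le_0D) (simp_all add: l2_summable)
    then show "\<xi> = 0" by (intro l2_eqI) (simp add: l2_fun_simps)
  qed (simp add: inner_l2_def cinner_def l2_fun_simps)
qed (rule uniformity_l2_def open_l2_def)+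

end

section \<open>Bounded operators and the predual\<close>

definition BL2 :: "('a l2 \<Rightarrow> 'a l2) set" where
  "BL2 = {T. bounded_linear T \<and> (\<forall>c \<xi>. T (c *\<^sub>C \<xi>) = c *\<^sub>C T \<xi>)}"

definition adj :: "('a l2 \<Rightarrow> 'a l2) \<Rightarrow> 'a l2 \<Rightarrow> 'a l2" where
  "adj T = (THE S. \<forall>\<xi> \<eta>. cinner (T \<xi>) \<eta> = cinner \<xi> (S \<eta>))"

lemma module_operators: "module (\<lambda>c (T :: 'a l2 \<Rightarrow> 'a l2) \<xi>. c *\<^sub>C T \<xi>)"
  by unfold_locales
    (auto intro!: ext l2_eqI simp: plus_fun_def l2_fun_simps algebra_simps)

lemma module_functions: "module (\<lambda>(c :: complex) (f :: 'x \<Rightarrow> complex) x. c * f x)"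
  by unfold_locales (auto simp: fun_eq_iff plus_fun_def algebra_simps)

abbreviation op_span :: "('a l2 \<Rightarrow> 'a l2) set \<Rightarrow> ('a l2 \<Rightarrow> 'a l2) set" where
  "op_span \<equiv> module.span (\<lambda>c T \<xi>. c *\<^sub>C T \<xi>)"

abbreviation fun_span :: "('x \<Rightarrow> complex) set \<Rightarrow> ('x \<Rightarrow> complex) set" where
  "fun_span \<equiv> module.span (\<lambda>c f x. c * f x)"

abbreviation fun_subspace :: "('x \<Rightarrow> complex) set \<Rightarrow> bool" where
  "fun_subspace \<equiv> module.subspace (\<lambda>c f x. c * f x)"

definition represents :: "(nat \<Rightarrow> 'a l2) \<Rightarrow> (nat \<Rightarrow> 'a l2) \<Rightarrow> ('a \<times> 'a \<Rightarrow> complex) \<Rightarrow> bool" where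
  "represents f g h \<longleftrightarrow>
     summable (\<lambda>i. (norm (f i))\<^sup>2) \<and> summable (\<lambda>i. (norm (g i))\<^sup>2) \<and>
     (\<forall>x y. h (x, y) = (\<Sum>i. l2_fun (f i) x * l2_fun (g i) y))"

definition trace_class :: "('a \<times> 'a \<Rightarrow> complex) set" where
  "trace_class = {h. \<exists>f g. represents f g h}"

text \<open>The value does not depend on the representation of \<open>h\<close>.\<close>

definition tpair :: "('a l2 \<Rightarrow> 'a l2) \<Rightarrow> ('a \<times> 'a \<Rightarrow> complex) \<Rightarrow> complex" where
  "tpair T h = (THE c. \<exists>f g. represents f g h \<and> c = (\<Sum>i. cinner (T (f i)) (l2_cnj (g i))))"

text \<open>The trace norm is the norm of \<open>h\<close> as a functional on \<open>BL2\<close>.\<close>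

definition tnorm :: "('a \<times> 'a \<Rightarrow> complex) \<Rightarrow> real" where
  "tnorm h = (SUP T\<in>{T \<in> BL2. onorm T \<le> 1}. cmod (tpair T h))"

definition weak_star :: "('a l2 \<Rightarrow> 'a l2) topology" where
  "weak_star = topology_generated_by
     {{T \<in> BL2. tpair T h \<in> U} | h U. h \<in> trace_class \<and> open U}"

definition annihilator :: "('a \<times> 'a \<Rightarrow> complex) set \<Rightarrow> ('a l2 \<Rightarrow> 'a l2) set" where
  "annihilator R = {T \<in> BL2. \<forall>h\<in>R. tpair T h = 0}"

section \<open>Regular representations, \<open>VN(G)\<close> and multiplication operators\<close>

lift_definition lam :: "'g :: group_add \<Rightarrow> 'g l2 \<Rightarrow> 'g l2"
  is "\<lambda>s f t. f (- s + t)"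
proof -
  fix s :: 'g and f :: "'g \<Rightarrow> complex"
  assume *: "(\<lambda>x. (cmod (f x))\<^sup>2) summable_on UNIV"
  have "bij_betw (\<lambda>t. - s + t) (UNIV :: 'g set) UNIV"
    by (rule bij_betwI[where g = "\<lambda>t. s + t"]) (simp_all add: add.assoc[symmetric])
  from summable_on_reindex_bij_betw[OF this, of "\<lambda>x. (cmod (f x))\<^sup>2"] *
  show "(\<lambda>t. (cmod (f (- s + t)))\<^sup>2) summable_on UNIV" by simp
qed

lift_definition rho :: "'g :: group_add \<Rightarrow> 'g l2 \<Rightarrow> 'g l2"
  is "\<lambda>r f s. f (s + r)"
proof -
  fix r :: 'g and f :: "'g \<Rightarrow> complex"
  assume *: "(\<lambda>x. (cmod (f x))\<^sup>2) summable_on UNIV"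
  have "bij_betw (\<lambda>s. s + r) (UNIV :: 'g set) UNIV"
    by (rule bij_betwI[where g = "\<lambda>s. s + - r"]) (simp_all add: add.assoc)
  from summable_on_reindex_bij_betw[OF this, of "\<lambda>x. (cmod (f x))\<^sup>2"] *
  show "(\<lambda>s. (cmod (f (s + r)))\<^sup>2) summable_on UNIV" by simp
qed

definition VN :: "('g :: group_add l2 \<Rightarrow> 'g l2) set" where
  "VN = weak_star closure_of (op_span (range lam))"

definition Linfty :: "('a \<Rightarrow> complex) set" where
  "Linfty = {a. bounded (range a)}"

definition mult_op :: "('a \<Rightarrow> complex) \<Rightarrow> 'a l2 \<Rightarrow> 'a l2" where
  "mult_op a \<xi> = Abs_l2 (\<lambda>x. a x * l2_fun \<xi> x)"

lemma l2_fun_mult_op: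
  assumes "a \<in> Linfty"
  shows "l2_fun (mult_op a \<xi>) x = a x * l2_fun \<xi> x"
proof -
  obtain C where C: "\<And>x. cmod (a x) \<le> C"
    using assms unfolding Linfty_def bounded_iff by auto
  have "(\<lambda>x. (cmod (a x * l2_fun \<xi> x))\<^sup>2) summable_on UNIV"
  proof (rule summable_on_comparison_test)
    show "(\<lambda>x. C\<^sup>2 * (cmod (l2_fun \<xi> x))\<^sup>2) summable_on UNIV"
      by (intro summable_on_cmult_right l2_summable)
    show "(cmod (a x * l2_fun \<xi> x))\<^sup>2 \<le> C\<^sup>2 * (cmod (l2_fun \<xi> x))\<^sup>2" for x
      using C[of x] by (auto simp: norm_mult power_mult_distrib intro!: mult_right_mono power_mono)
  qed simp
  then show ?thesis by (simp add: mult_op_def Abs_l2_inverse)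
qed

definition Bim :: "('g :: group_add \<Rightarrow> complex) set \<Rightarrow> ('g l2 \<Rightarrow> 'g l2) set" where
  "Bim \<U> = weak_star closure_of
     (op_span {A \<circ> mult_op a \<circ> B | A B a. A \<in> VN \<and> B \<in> VN \<and> a \<in> \<U>})"

section \<open>The convolution algebra \<open>L\<^sup>1(G)\<close> and its ideals\<close>

definition L1 :: "('a \<Rightarrow> complex) set" where
  "L1 = {f. (\<lambda>x. cmod (f x)) summable_on UNIV}"

definition L1_norm :: "('a \<Rightarrow> complex) \<Rightarrow> real" where
  "L1_norm f = (\<Sum>\<^sub>\<infinity>x. cmod (f x))"

definition convolve :: "('g :: group_add \<Rightarrow> complex) \<Rightarrow> ('g \<Rightarrow> complex) \<Rightarrow> 'g \<Rightarrow> complex" where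
  "convolve f g s = (\<Sum>\<^sub>\<infinity>t. f t * g (- t + s))"

definition closed_left_ideal :: "('g :: group_add \<Rightarrow> complex) set \<Rightarrow> bool" where
  "closed_left_ideal J \<longleftrightarrow>
     J \<subseteq> L1 \<and> fun_subspace J \<and>
     (\<forall>f\<in>L1. \<forall>g\<in>J. convolve f g \<in> J) \<and>
     (\<forall>f\<in>L1. (\<forall>e>0. \<exists>g\<in>J. L1_norm (\<lambda>x. f x - g x) < e) \<longrightarrow> f \<in> J)"

definition L1_perp :: "('a \<Rightarrow> complex) set \<Rightarrow> ('a \<Rightarrow> complex) set" where
  "L1_perp J = {a \<in> Linfty. \<forall>f\<in>J. (\<Sum>\<^sub>\<infinity>x. a x * f x) = 0}"

text \<open>\<open>Theta f\<close> and its preadjoint \<open>theta f\<close>, for the measure with density \<open>f\<close>.\<close>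

definition Theta :: "('g :: group_add \<Rightarrow> complex) \<Rightarrow> ('g l2 \<Rightarrow> 'g l2) \<Rightarrow> 'g l2 \<Rightarrow> 'g l2" where
  "Theta f T = (THE S. S \<in> BL2 \<and>
     (\<forall>h\<in>trace_class. tpair S h = (\<Sum>\<^sub>\<infinity>r. f r * tpair (rho r \<circ> T \<circ> adj (rho r)) h)))"

definition theta ::
  "('g :: group_add \<Rightarrow> complex) \<Rightarrow> ('g \<times> 'g \<Rightarrow> complex) \<Rightarrow> 'g \<times> 'g \<Rightarrow> complex" where
  "theta f h = (THE k. k \<in> trace_class \<and> (\<forall>T\<in>BL2. tpair T k = tpair (Theta f T) h))"

definition Ran :: "('g :: group_add \<Rightarrow> complex) set \<Rightarrow> ('g \<times> 'g \<Rightarrow> complex) set" where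
  "Ran J = {h \<in> trace_class. \<forall>e>0.
     \<exists>k \<in> fun_span {theta f h' | f h'. f \<in> J \<and> h' \<in> trace_class}. tnorm (\<lambda>p. h p - k p) < e}"

section \<open>The Fourier algebra, completely bounded multipliers and weak amenability\<close>

definition fourier_algebra :: "('g :: group_add \<Rightarrow> complex) set" where
  "fourier_algebra = {v. \<exists>\<xi> \<eta>. \<forall>x. v x = cinner (lam x \<xi>) \<eta>}"

text \<open>The duality between \<open>VN(G)\<close> and \<open>A(G)\<close>, normalised by \<open>\<langle>\<lambda>\<^sub>x, v\<rangle> = v(x)\<close>; for
  \<open>T \<in> VN(G)\<close> the value does not depend on the choice of \<open>\<xi>\<close> and \<open>\<eta>\<close>.\<close>

definition vn_pair :: "('g :: group_add l2 \<Rightarrow> 'g l2) \<Rightarrow> ('g \<Rightarrow> complex) \<Rightarrow> complex" where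
  "vn_pair T v = (THE c. \<exists>\<xi> \<eta>. (\<forall>x. v x = cinner (lam x \<xi>) \<eta>) \<and> c = cinner (T \<xi>) \<eta>)"

definition mult_dual ::
  "('g :: group_add \<Rightarrow> complex) \<Rightarrow> ('g l2 \<Rightarrow> 'g l2) \<Rightarrow> 'g l2 \<Rightarrow> 'g l2" where
  "mult_dual u T =
     (THE S. S \<in> VN \<and> (\<forall>v\<in>fourier_algebra. vn_pair S v = vn_pair T (\<lambda>x. u x * v x)))"

definition matrix_norm :: "nat \<Rightarrow> (nat \<Rightarrow> nat \<Rightarrow> 'a l2 \<Rightarrow> 'a l2) \<Rightarrow> real" where
  "matrix_norm n X =
     (SUP \<xi>\<in>{\<xi> :: nat \<Rightarrow> 'a l2. (\<Sum>j<n. (norm (\<xi> j))\<^sup>2) \<le> 1}.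
        sqrt (\<Sum>i<n. (norm (\<Sum>j<n. X i j (\<xi> j)))\<^sup>2))"

definition cb_norm :: "(('g :: group_add l2 \<Rightarrow> 'g l2) \<Rightarrow> 'g l2 \<Rightarrow> 'g l2) \<Rightarrow> ennreal" where
  "cb_norm \<Phi> =
     (SUP n. SUP X\<in>{X. (\<forall>i<n. \<forall>j<n. X i j \<in> VN) \<and> matrix_norm n X \<le> 1}.
        ennreal (matrix_norm n (\<lambda>i j. \<Phi> (X i j))))"

definition mcb_norm :: "('g :: group_add \<Rightarrow> complex) \<Rightarrow> ennreal" where
  "mcb_norm u = cb_norm (mult_dual u)"

text \<open>A net of functions enters through the filter generated by its tails.\<close>

definition weakly_amenable :: "'g :: group_add itself \<Rightarrow> bool" where
  "weakly_amenable _ \<longleftrightarrow>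
     (\<exists>(F :: ('g \<Rightarrow> complex) filter) (L :: real). F \<noteq> bot \<and> L > 0 \<and>
        (\<forall>\<^sub>F u in F. u \<in> fourier_algebra \<and> finite {s. u s \<noteq> 0} \<and> mcb_norm u \<le> ennreal L) \<and>
        (\<forall>s. ((\<lambda>u. u s) \<longlongrightarrow> 1) F))"

end

theory Submission
  imports Defs
begin

text \<open>
  Write \<open>T\<^sub>s\<^sub>t = (T \<delta>\<^sub>t)(s)\<close>. Since \<open>\<Theta>(f)(T)\<close> has the entries \<open>\<Sum>\<^sub>r f(r) T\<^sub>s\<^sub>r\<^sub>,\<^sub>t\<^sub>r\<close> and \<open>J\<close> is invariant under
  left translation, \<open>T\<close> annihilates \<open>Ran J\<close> iff each of its diagonals \<open>r \<mapsto> T\<^sub>r\<^sub>,\<^sub>z\<^sub>r\<close> lies in \<open>J\<^sup>\<bottom>\<close>. This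
  condition is weak* closed and holds for \<open>\<lambda>\<^sub>x M\<^sub>a \<lambda>\<^sub>y\<close> with \<open>a \<in> J\<^sup>\<bottom>\<close>, hence on the bimodule.

  Conversely, if \<open>u\<close> has finite support, then the Schur product of \<open>T\<close> with \<open>u(st\<^sup>-\<^sup>1)\<close> is a finite sum of
  operators \<open>M\<^sub>a \<lambda>\<^sub>z\<close> with \<open>a\<close> a diagonal of \<open>T\<close>, so it belongs to the bimodule. Its norm is at most
  \<open>\<parallel>u\<parallel>\<^sub>m\<^sub>c\<^sub>b \<parallel>T\<parallel>\<close>: on a finite set \<open>{s\<^sub>1, \<dots>, s\<^sub>n}\<close> the matrix \<open>(T\<^sub>i\<^sub>j \<lambda>(s\<^sub>i s\<^sub>j\<^sup>-\<^sup>1))\<close> over \<open>VN(G)\<close> is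
  \<open>D (T \<otimes> 1) D\<^sup>*\<close> for the diagonal unitary \<open>D\<close> with entries \<open>\<lambda>(s\<^sub>i)\<close>, and the multiplier \<open>u\<close> acts on it as the
  Schur product acts on \<open>T\<close>. Along the net given by weak amenability these Schur products are therefore
  bounded and converge to \<open>T\<close> entrywise, hence weak*.
\<close>

section \<open>The Hilbert space\<close>

lemma cinner_commute: "cinner \<eta> \<xi> = cnj (cinner \<xi> \<eta>)"
  unfolding cinner_def infsum_cnj[symmetric] by (rule infsum_cong) simp

lemma cinner_add_left: "cinner (\<xi> + \<eta>) \<zeta> = cinner \<xi> \<zeta> + cinner \<eta> \<zeta>"
  unfolding cinner_def by (simp add: l2_fun_simps ring_distribs infsum_add cinner_summable)

lemma cinner_scaleC_left: "cinner (c *\<^sub>C \<xi>) \<eta> = c * cinner \<xi> \<eta>"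
  unfolding cinner_def by (simp add: l2_fun_simps mult.assoc infsum_cmult_right cinner_summable)

lemma cinner_add_right: "cinner \<zeta> (\<xi> + \<eta>) = cinner \<zeta> \<xi> + cinner \<zeta> \<eta>"
  using cinner_commute[of \<zeta> "\<xi> + \<eta>"] cinner_commute[of \<zeta> \<xi>] cinner_commute[of \<zeta> \<eta>]
  by (simp add: cinner_add_left)

lemma cinner_scaleC_right: "cinner \<xi> (c *\<^sub>C \<eta>) = cnj c * cinner \<xi> \<eta>"
  using cinner_commute[of \<xi> "c *\<^sub>C \<eta>"] cinner_commute[of \<xi> \<eta>]
  by (simp add: cinner_scaleC_left)

lemma l2_fun_minus: "l2_fun (\<xi> - \<eta>) x = l2_fun \<xi> x - l2_fun \<eta> x"
  by (simp only: minus_l2_def l2_fun_simps diff_conv_add_uminus)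

lemma l2_fun_scaleR: "l2_fun (r *\<^sub>R \<xi>) x = complex_of_real r * l2_fun \<xi> x"
  by (simp add: scaleR_l2_def l2_fun_simps)

lemma l2_fun_sum: "l2_fun (\<Sum>i\<in>F. f i) x = (\<Sum>i\<in>F. l2_fun (f i) x)"
  by (induction F rule: infinite_finite_induct) (auto simp: l2_fun_simps)

lemma scaleC_simps:
  "c *\<^sub>C (\<xi> + \<eta>) = c *\<^sub>C \<xi> + c *\<^sub>C \<eta>" "c *\<^sub>C (\<xi> - \<eta>) = c *\<^sub>C \<xi> - c *\<^sub>C \<eta>"
  "c *\<^sub>C d *\<^sub>C \<xi> = (c * d) *\<^sub>C \<xi>" "1 *\<^sub>C \<xi> = \<xi>" "0 *\<^sub>C \<xi> = 0" "c *\<^sub>C (0 :: 'a l2) = 0"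
  "c *\<^sub>C (r *\<^sub>R \<xi>) = r *\<^sub>R (c *\<^sub>C \<xi>)"
  by (rule l2_eqI, simp add: l2_fun_simps l2_fun_minus l2_fun_scaleR ring_distribs)+

lemma power2_norm_l2: "(norm \<xi>)\<^sup>2 = (\<Sum>\<^sub>\<infinity>x. (cmod (l2_fun \<xi> x))\<^sup>2)"
  unfolding norm_l2_def by (intro real_sqrt_pow2 infsum_nonneg) simp

lemma norm_scaleC: "norm (c *\<^sub>C \<xi>) = cmod c * norm \<xi>"
proof -
  have "(norm (c *\<^sub>C \<xi>))\<^sup>2 = (cmod c * norm \<xi>)\<^sup>2"
    by (simp add: power2_norm_l2 power_mult_distrib l2_fun_simps norm_mult infsum_cmult_right'
        del: infsum_cmult_right)
  then show ?thesis by (simp add: power2_eq_iff_nonneg)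
qed

lemma norm_l2_cnj: "norm (l2_cnj \<xi>) = norm \<xi>"
  by (simp add: norm_l2_def l2_cnj.rep_eq)

lemma l2_cnj_cnj [simp]: "l2_cnj (l2_cnj \<xi>) = \<xi>"
  by (rule l2_eqI) (simp add: l2_cnj.rep_eq)

lemma l2_cnj_scaleC: "l2_cnj (c *\<^sub>C \<xi>) = cnj c *\<^sub>C l2_cnj \<xi>"
  by (rule l2_eqI) (simp add: l2_cnj.rep_eq l2_fun_simps)

text \<open>The Cauchy-Schwarz inequality of \<open>real_inner\<close> controls only the real part
  of \<open>cinner\<close>. Multiplying \<open>\<xi>\<close> by the unimodular \<open>c\<close>
  rotates \<open>cinner \<xi> \<eta>\<close> onto the nonnegative reals, where real part and modulus
  agree.\<close>

lemma cinner_bound: "cmod (cinner \<xi> \<eta>) \<le> norm \<xi> * norm \<eta>"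
proof (cases "cinner \<xi> \<eta> = 0")
  case False
  define c where "c = cnj (cinner \<xi> \<eta>) / cmod (cinner \<xi> \<eta>)"
  have c: "cmod c = 1" using False by (simp add: c_def norm_divide)
  have "c * cinner \<xi> \<eta> = (cinner \<xi> \<eta> * cnj (cinner \<xi> \<eta>)) / cmod (cinner \<xi> \<eta>)"
    by (simp add: c_def)
  also have "cinner \<xi> \<eta> * cnj (cinner \<xi> \<eta>) = complex_of_real ((cmod (cinner \<xi> \<eta>))\<^sup>2)"
    by (rule complex_norm_square[symmetric])
  also have "\<dots> / cmod (cinner \<xi> \<eta>) = complex_of_real (cmod (cinner \<xi> \<eta>))"
    using False by (simp add: power2_eq_square)
  finally have "cmod (cinner \<xi> \<eta>) = Re (cinner (c *\<^sub>C \<xi>) \<eta>)"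
    by (simp add: cinner_scaleC_left)
  also have "\<dots> \<le> norm (c *\<^sub>C \<xi>) * norm \<eta>"
    using norm_cauchy_schwarz[of "c *\<^sub>C \<xi>" \<eta>] by (simp add: inner_l2_def)
  finally show ?thesis by (simp add: norm_scaleC c)
qed simp

lemma bounded_linear_cinner_left: "bounded_linear (\<lambda>\<xi>. cinner \<xi> \<eta>)"
  by (rule bounded_linear_intro[where K = "norm \<eta>"])
    (auto simp: cinner_add_left cinner_scaleC_left scaleR_l2_def scaleR_conv_of_real cinner_bound)

lemma bounded_linear_cinner_right: "bounded_linear (cinner \<eta>)"
  by (rule bounded_linear_intro[where K = "norm \<eta>"])
    (auto simp: cinner_add_right cinner_scaleC_right scaleR_l2_def scaleR_conv_of_real
      mult.commute[of "norm _" "norm \<eta>"] cinner_bound)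

lemma cinner_zero [simp]: "cinner 0 \<xi> = 0" "cinner \<xi> 0 = 0"
  by (simp_all add: cinner_def l2_fun_simps)

lemma cinner_diff_left: "cinner (\<xi> - \<eta>) \<zeta> = cinner \<xi> \<zeta> - cinner \<eta> \<zeta>"
  by (rule bounded_linear.linear[OF bounded_linear_cinner_left, THEN linear_diff])

lemma cinner_diff_right: "cinner \<zeta> (\<xi> - \<eta>) = cinner \<zeta> \<xi> - cinner \<zeta> \<eta>"
  by (rule bounded_linear.linear[OF bounded_linear_cinner_right, THEN linear_diff])

section \<open>The standard orthonormal basis and completeness of the space\<close>

lift_definition ket :: "'a \<Rightarrow> 'a l2" is "\<lambda>x y. of_bool (y = x)"
proof -
  fix x :: 'a
  have "(\<lambda>y. (cmod (of_bool (y = x)))\<^sup>2) summable_on UNIV \<longleftrightarrow>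
    (\<lambda>y. (cmod (of_bool (y = x)))\<^sup>2) summable_on {x}"
    by (rule summable_on_cong_neutral) auto
  then show "(\<lambda>y. (cmod (of_bool (y = x)))\<^sup>2) summable_on UNIV" by simp
qed

lemma infsum_single_UNIV:
  assumes "\<And>y. y \<noteq> x \<Longrightarrow> f y = 0"
  shows "infsum f UNIV = f x"
proof -
  have "infsum f UNIV = infsum f {x}" using assms by (intro infsum_cong_neutral) auto
  then show ?thesis by simp
qed

lemma cinner_ket_right: "cinner \<xi> (ket x) = l2_fun \<xi> x"
  unfolding cinner_def by (subst infsum_single_UNIV[of x]) (simp_all add: ket.rep_eq)

lemma norm_ket [simp]: "norm (ket x) = 1"
  unfolding norm_l2_def by (subst infsum_single_UNIV[of x]) (simp_all add: ket.rep_eq)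

lemma l2_cnj_ket [simp]: "l2_cnj (ket x) = ket x"
  by (rule l2_eqI) (simp add: l2_cnj.rep_eq ket.rep_eq)

lemma l2_fun_le_norm: "cmod (l2_fun \<xi> x) \<le> norm \<xi>"
  using cinner_bound[of \<xi> "ket x"] by (simp add: cinner_ket_right)

lemma sum_le_norm_l2: "finite F \<Longrightarrow> (\<Sum>x\<in>F. (cmod (l2_fun \<xi> x))\<^sup>2) \<le> (norm \<xi>)\<^sup>2"
  unfolding power2_norm_l2 by (rule finite_sum_le_infsum) (simp_all add: l2_summable)

lemma norm_l2_leI:
  assumes "\<And>F. finite F \<Longrightarrow> (\<Sum>x\<in>F. (cmod (l2_fun \<xi> x))\<^sup>2) \<le> e\<^sup>2" and "e \<ge> 0"
  shows "norm \<xi> \<le> e"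
proof -
  have "(norm \<xi>)\<^sup>2 \<le> e\<^sup>2"
    unfolding power2_norm_l2 by (rule infsum_le_finite_sums) (simp_all add: l2_summable assms)
  then show ?thesis using assms(2) power2_le_imp_le by blast
qed

text \<open>A Cauchy sequence converges pointwise, and bounds on finite partial sums of squares
  survive the pointwise limit. Completeness is used later to sum the vector series defining
  \<open>Theta f T\<close>.\<close>

instance l2 :: (type) banach
proof
  fix X :: "nat \<Rightarrow> 'a l2"
  assume X: "Cauchy X"
  have "Cauchy (\<lambda>n. l2_fun (X n) x)" for x
    using bounded_linear.Cauchy[OF bounded_linear_cinner_left[of "ket x"] X]
    by (simp add: cinner_ket_right)
  then have "\<exists>l. (\<lambda>n. l2_fun (X n) x) \<longlonglongrightarrow> l" for x
    using Cauchy_convergent convergent_def by blast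
  then obtain g where g: "\<And>x. (\<lambda>n. l2_fun (X n) x) \<longlonglongrightarrow> g x" by metis
  have *: "(\<Sum>x\<in>F. (cmod (g x - l2_fun (X n) x))\<^sup>2) \<le> e\<^sup>2"
    if e: "\<And>m. m \<ge> n \<Longrightarrow> norm (X m - X n) < e" and F: "finite F" for n e F
  proof (rule tendsto_upperbound)
    show "(\<lambda>m. \<Sum>x\<in>F. (cmod (l2_fun (X m) x - l2_fun (X n) x))\<^sup>2)
      \<longlonglongrightarrow> (\<Sum>x\<in>F. (cmod (g x - l2_fun (X n) x))\<^sup>2)"
      by (intro tendsto_intros g)
    have "(\<Sum>x\<in>F. (cmod (l2_fun (X m) x - l2_fun (X n) x))\<^sup>2) \<le> e\<^sup>2" if "m \<ge> n" for m
    proof -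
      have "(\<Sum>x\<in>F. (cmod (l2_fun (X m - X n) x))\<^sup>2) \<le> (norm (X m - X n))\<^sup>2"
        by (rule sum_le_norm_l2[OF F])
      also have "\<dots> \<le> e\<^sup>2" using e[OF that] by (intro power_mono) auto
      finally show ?thesis by (simp add: l2_fun_minus)
    qed
    then show "\<forall>\<^sub>F m in sequentially. (\<Sum>x\<in>F. (cmod (l2_fun (X m) x - l2_fun (X n) x))\<^sup>2) \<le> e\<^sup>2"
      using eventually_at_top_linorder by blast
  qed simp
  have ex: "\<exists>N. \<forall>n\<ge>N. \<forall>m\<ge>n. norm (X m - X n) < e" if "e > 0" for e
    using X that unfolding Cauchy_def dist_norm by (meson order.trans)
  obtain N where N: "\<And>m. m \<ge> N \<Longrightarrow> norm (X m - X N) < 1" using ex[of 1] by auto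
  \<comment> \<open>Square summability is shown for the difference from one member
    \<open>X N\<close> of the sequence, where the Cauchy bound applies; adding \<open>X N\<close>
    back gives it for \<open>g\<close>.\<close>
  have "(\<lambda>x. (cmod (g x - l2_fun (X N) x))\<^sup>2) summable_on UNIV"
    by (rule nonneg_bounded_partial_sums_imp_summable_on[where C = 1])
      (use *[of N 1] N in \<open>auto intro!: eventually_finite_subsets_at_top_weakI\<close>)
  then have "(\<lambda>x. (cmod ((g x - l2_fun (X N) x) + l2_fun (X N) x))\<^sup>2) summable_on UNIV"
    by (intro l2_add_closed l2_summable)
  then have g2: "(\<lambda>x. (cmod (g x))\<^sup>2) summable_on UNIV" by simp
  define G where "G = Abs_l2 g"
  have G: "l2_fun G x = g x" for x using g2 by (simp add: G_def Abs_l2_inverse)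
  have "X \<longlonglongrightarrow> G"
    unfolding LIMSEQ_iff
  proof (intro allI impI)
    fix e :: real assume e: "e > 0"
    obtain N where N: "\<And>n m. n \<ge> N \<Longrightarrow> m \<ge> n \<Longrightarrow> norm (X m - X n) < e/2"
      using ex[of "e/2"] e by auto
    have "norm (G - X n) \<le> e/2" if "n \<ge> N" for n
      by (rule norm_l2_leI) (use *[of n "e/2"] N[OF that] e in \<open>auto simp: l2_fun_minus G\<close>)
    then have "norm (X n - G) < e" if "n \<ge> N" for n
      using that e by (smt (verit) field_sum_of_halves norm_minus_commute)
    then show "\<exists>no. \<forall>n\<ge>no. norm (X n - G) < e" by blast
  qed
  then show "convergent X" by (auto simp: convergent_def)
qed

section \<open>Finite truncations\<close>

text \<open>The orthogonal projection onto the span of the basis vectors with index in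
  \<open>F\<close>.\<close>

definition trunc :: "'a set \<Rightarrow> 'a l2 \<Rightarrow> 'a l2" where
  "trunc F \<xi> = (\<Sum>x\<in>F. l2_fun \<xi> x *\<^sub>C ket x)"

lemma l2_fun_trunc: "finite F \<Longrightarrow> l2_fun (trunc F \<xi>) x = (if x \<in> F then l2_fun \<xi> x else 0)"
proof -
  assume "finite F"
  have "l2_fun (trunc F \<xi>) x = (\<Sum>y\<in>F. if x = y then l2_fun \<xi> y else 0)"
    unfolding trunc_def l2_fun_sum by (rule sum.cong) (auto simp: l2_fun_simps ket.rep_eq)
  with \<open>finite F\<close> show ?thesis by simp
qed

lemma norm_trunc_le: "finite F \<Longrightarrow> norm (trunc F \<xi>) \<le> norm \<xi>"
proof (rule norm_l2_leI)
  fix E :: "'a set" assume F: "finite F" and E: "finite E"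
  have "(\<Sum>x\<in>E. (cmod (l2_fun (trunc F \<xi>) x))\<^sup>2) \<le> (\<Sum>x\<in>E. (cmod (l2_fun \<xi> x))\<^sup>2)"
    by (intro sum_mono) (simp add: l2_fun_trunc F)
  also have "\<dots> \<le> (norm \<xi>)\<^sup>2" by (rule sum_le_norm_l2[OF E])
  finally show "(\<Sum>x\<in>E. (cmod (l2_fun (trunc F \<xi>) x))\<^sup>2) \<le> (norm \<xi>)\<^sup>2" .
qed simp

lemma norm_diff_trunc:
  assumes F: "finite F"
  shows "(norm (\<xi> - trunc F \<xi>))\<^sup>2 = (norm \<xi>)\<^sup>2 - (\<Sum>x\<in>F. (cmod (l2_fun \<xi> x))\<^sup>2)"
proof -
  have "(norm (\<xi> - trunc F \<xi>))\<^sup>2 = (\<Sum>\<^sub>\<infinity>x\<in>UNIV - F. (cmod (l2_fun \<xi> x))\<^sup>2)"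
    unfolding power2_norm_l2 by (rule infsum_cong_neutral) (auto simp: l2_fun_minus l2_fun_trunc F)
  also have "\<dots> = (norm \<xi>)\<^sup>2 - (\<Sum>x\<in>F. (cmod (l2_fun \<xi> x))\<^sup>2)"
    unfolding power2_norm_l2 using F by (subst infsum_Diff) (auto simp: l2_summable)
  finally show ?thesis .
qed

text \<open>By Pythagoras, as in \<open>norm_diff_trunc\<close>, the error is the part of the sum of
  squares outside \<open>F\<close>, which tends to 0.\<close>

lemma trunc_tendsto: "((\<lambda>F. trunc F \<xi>) \<longlongrightarrow> \<xi>) (finite_subsets_at_top UNIV)"
proof -
  have "((\<lambda>F. \<Sum>x\<in>F. (cmod (l2_fun \<xi> x))\<^sup>2) \<longlongrightarrow> (norm \<xi>)\<^sup>2) (finite_subsets_at_top UNIV)"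
    using has_sum_infsum[OF l2_summable[of \<xi>]] by (simp add: has_sum_def power2_norm_l2)
  then have "((\<lambda>F. sqrt ((norm \<xi>)\<^sup>2 - (\<Sum>x\<in>F. (cmod (l2_fun \<xi> x))\<^sup>2))) \<longlongrightarrow>
    sqrt ((norm \<xi>)\<^sup>2 - (norm \<xi>)\<^sup>2)) (finite_subsets_at_top UNIV)"
    by (intro tendsto_intros)
  moreover have "norm (\<xi> - trunc F \<xi>) = sqrt ((norm \<xi>)\<^sup>2 - (\<Sum>x\<in>F. (cmod (l2_fun \<xi> x))\<^sup>2))"
    if "finite F" for F
    by (rule real_sqrt_unique[symmetric]) (simp_all add: norm_diff_trunc that)
  ultimately have "((\<lambda>F. norm (\<xi> - trunc F \<xi>)) \<longlongrightarrow> 0) (finite_subsets_at_top UNIV)"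
    by (subst filterlim_cong[OF refl refl eventually_finite_subsets_at_top_weakI]) auto
  then show ?thesis
    by (simp add: tendsto_iff dist_norm norm_minus_commute)
qed

lemma l2_cnj_trunc: "finite F \<Longrightarrow> l2_cnj (trunc F \<xi>) = trunc F (l2_cnj \<xi>)"
  by (rule l2_eqI) (simp add: l2_cnj.rep_eq l2_fun_trunc)

section \<open>Bounded operators\<close>

lemma BL2_I:
  assumes "\<And>\<xi> \<eta>. T (\<xi> + \<eta>) = T \<xi> + T \<eta>" and "\<And>c \<xi>. T (c *\<^sub>C \<xi>) = c *\<^sub>C T \<xi>"
    and "\<And>\<xi>. norm (T \<xi>) \<le> norm \<xi> * K"
  shows "T \<in> BL2"
  unfolding BL2_def
  using assms by (auto intro!: bounded_linear_intro[where K = K] simp: scaleR_l2_def)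

lemma BL2_bounded_linear: "T \<in> BL2 \<Longrightarrow> bounded_linear T"
  by (simp add: BL2_def)

lemma BL2_scaleC: "T \<in> BL2 \<Longrightarrow> T (c *\<^sub>C \<xi>) = c *\<^sub>C T \<xi>"
  by (simp add: BL2_def)

lemma BL2_add: "T \<in> BL2 \<Longrightarrow> T (\<xi> + \<eta>) = T \<xi> + T \<eta>"
  by (simp add: BL2_bounded_linear linear_simps(1))

lemma BL2_diff: "T \<in> BL2 \<Longrightarrow> T (\<xi> - \<eta>) = T \<xi> - T \<eta>"
  by (simp add: BL2_bounded_linear linear_simps(2))

lemma BL2_sum: "T \<in> BL2 \<Longrightarrow> T (\<Sum>i\<in>F. f i) = (\<Sum>i\<in>F. T (f i))"
  by (simp add: BL2_bounded_linear bounded_linear.linear linear_sum)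

lemma BL2_norm_le: "T \<in> BL2 \<Longrightarrow> norm (T \<xi>) \<le> onorm T * norm \<xi>"
  by (simp add: BL2_bounded_linear onorm)

lemma BL2_tendsto: "T \<in> BL2 \<Longrightarrow> (f \<longlongrightarrow> \<xi>) F \<Longrightarrow> ((\<lambda>u. T (f u)) \<longlongrightarrow> T \<xi>) F"
  by (simp add: BL2_bounded_linear bounded_linear.tendsto)

lemma BL2_compose: "S \<in> BL2 \<Longrightarrow> T \<in> BL2 \<Longrightarrow> S \<circ> T \<in> BL2"
  by (simp add: BL2_def bounded_linear_compose[of S T] o_def)

lemma BL2_op_scaleC: "T \<in> BL2 \<Longrightarrow> (\<lambda>\<xi>. c *\<^sub>C T \<xi>) \<in> BL2"
proof (rule BL2_I[where K = "cmod c * onorm T"])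
  fix \<xi> assume "T \<in> BL2"
  then have "cmod c * norm (T \<xi>) \<le> cmod c * (onorm T * norm \<xi>)"
    by (intro mult_left_mono BL2_norm_le) auto
  then show "norm (c *\<^sub>C T \<xi>) \<le> norm \<xi> * (cmod c * onorm T)" by (simp add: norm_scaleC mult_ac)
qed (simp_all add: BL2_add BL2_scaleC scaleC_simps mult.commute)

lemma BL2_zero: "0 \<in> BL2"
  by (rule BL2_I[where K = 0]) (simp_all add: scaleC_simps)

lemma BL2_plus: "S \<in> BL2 \<Longrightarrow> T \<in> BL2 \<Longrightarrow> S + T \<in> BL2"
  unfolding BL2_def plus_fun_def by (auto intro: bounded_linear_add simp: scaleC_simps)

lemma BL2_op_sum: "(\<And>i. i \<in> F \<Longrightarrow> f i \<in> BL2) \<Longrightarrow> (\<Sum>i\<in>F. f i) \<in> BL2"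
  by (induction F rule: infinite_finite_induct) (simp_all add: BL2_zero BL2_plus)

lemma op_subspace_BL2: "module.subspace (\<lambda>c T \<xi>. c *\<^sub>C T \<xi>) BL2"
  by (simp add: module.subspace_def[OF module_operators] BL2_zero BL2_plus BL2_op_scaleC)

lemma op_span_subset_BL2: "A \<subseteq> BL2 \<Longrightarrow> op_span A \<subseteq> BL2"
  by (rule module.span_minimal[OF module_operators _ op_subspace_BL2])

lemma BL2_trunc: "T \<in> BL2 \<Longrightarrow> T (trunc F \<xi>) = (\<Sum>x\<in>F. l2_fun \<xi> x *\<^sub>C T (ket x))"
  by (simp add: trunc_def BL2_sum BL2_scaleC)

text \<open>Equal entries give equal values on all truncations, and these converge to the given
  vector.\<close>

lemma BL2_eqI:
  assumes S: "S \<in> BL2" and T: "T \<in> BL2"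
    and eq: "\<And>x y. l2_fun (S (ket y)) x = l2_fun (T (ket y)) x"
  shows "S = T"
proof
  fix \<xi>
  have "S (ket y) = T (ket y)" for y by (rule l2_eqI) (rule eq)
  then have "(\<lambda>F. S (trunc F \<xi>)) = (\<lambda>F. T (trunc F \<xi>))" by (simp add: BL2_trunc S T)
  with BL2_tendsto[OF S trunc_tendsto[of \<xi>]]
  have "((\<lambda>F. T (trunc F \<xi>)) \<longlongrightarrow> S \<xi>) (finite_subsets_at_top UNIV)" by simp
  then show "S \<xi> = T \<xi>"
    by (rule tendsto_unique[OF finite_subsets_at_top_neq_bot _ BL2_tendsto[OF T trunc_tendsto]])
qed

section \<open>The trace class pairing\<close>

lemma represents_summable_norm:
  assumes "represents f g h"
  shows "summable (\<lambda>i. norm (f i) * norm (g i))"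
proof (rule summable_comparison_test')
  show "summable (\<lambda>i. (norm (f i))\<^sup>2 + (norm (g i))\<^sup>2)"
    using assms by (simp add: represents_def summable_add)
  show "norm (norm (f i) * norm (g i)) \<le> (norm (f i))\<^sup>2 + (norm (g i))\<^sup>2" for i
  proof -
    have "2 * (norm (f i) * norm (g i)) \<le> (norm (f i))\<^sup>2 + (norm (g i))\<^sup>2"
      using sum_squares_bound[of "norm (f i)" "norm (g i)"] by (simp add: mult.assoc)
    moreover have "0 \<le> norm (f i) * norm (g i)" by simp
    ultimately show ?thesis unfolding real_norm_def by linarith
  qed
qed

lemma cinner_op_bound:
  assumes "T \<in> BL2"
  shows "cmod (cinner (T \<xi>) \<eta>) \<le> onorm T * (norm \<xi> * norm \<eta>)"
proof -
  have "cmod (cinner (T \<xi>) \<eta>) \<le> norm (T \<xi>) * norm \<eta>" by (rule cinner_bound)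
  also have "\<dots> \<le> (onorm T * norm \<xi>) * norm \<eta>"
    by (intro mult_right_mono BL2_norm_le assms) simp
  finally show ?thesis by (simp add: mult.assoc)
qed

lemma represents_summable_cinner:
  assumes "represents f g h" and "T \<in> BL2"
  shows "summable (\<lambda>i. cinner (T (f i)) (l2_cnj (g i)))"
proof (rule summable_comparison_test'[OF
        summable_mult[OF represents_summable_norm[OF assms(1)], of "onorm T"]])
  show "norm (cinner (T (f i)) (l2_cnj (g i))) \<le> onorm T * (norm (f i) * norm (g i))" for i
    using cinner_op_bound[OF assms(2), of "f i" "l2_cnj (g i)"] by (simp add: norm_l2_cnj)
qed

text \<open>The left-hand side involves only \<open>h\<close>, so \<open>tpair\<close> does not depend on the representation.\<close>

lemma represents_pair_tendsto:
  assumes T: "T \<in> BL2" and r: "represents f g h"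
  shows "((\<lambda>F. \<Sum>x\<in>F. \<Sum>y\<in>F. h (x, y) * l2_fun (T (ket x)) y) \<longlongrightarrow>
    (\<Sum>i. cinner (T (f i)) (l2_cnj (g i)))) (finite_subsets_at_top UNIV)"
proof -
  let ?a = "\<lambda>i F. cinner (T (trunc F (f i))) (l2_cnj (trunc F (g i)))"
  have fin: "\<forall>\<^sub>F F in finite_subsets_at_top UNIV. finite F"
    by (rule eventually_finite_subsets_at_top_weakI) simp
  have bound: "norm (?a i F) \<le> onorm T * (norm (f i) * norm (g i))" if "finite F" for i F
  proof -
    have "norm (?a i F) \<le> onorm T * (norm (trunc F (f i)) * norm (trunc F (g i)))"
      using cinner_op_bound[OF T, of "trunc F (f i)" "l2_cnj (trunc F (g i))"]
      by (simp add: norm_l2_cnj)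
    also have "\<dots> \<le> onorm T * (norm (f i) * norm (g i))"
      using that T by (intro mult_left_mono mult_mono norm_trunc_le onorm_pos_le BL2_bounded_linear) auto
    finally show ?thesis .
  qed
  have ev: "\<forall>\<^sub>F (i, F) in sequentially \<times>\<^sub>F finite_subsets_at_top UNIV.
      norm (?a i F) \<le> onorm T * (norm (f i) * norm (g i))"
    using eventually_prodI[OF always_eventually[of "\<lambda>_. True" sequentially] fin]
    by (rule eventually_mono) (auto intro: bound)
  have lim: "(?a i \<longlongrightarrow> cinner (T (f i)) (l2_cnj (g i))) (finite_subsets_at_top UNIV)" for i
  proof -
    have 1: "((\<lambda>F. T (trunc F (f i))) \<longlongrightarrow> T (f i)) (finite_subsets_at_top UNIV)"
      by (rule BL2_tendsto[OF T trunc_tendsto])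
    have 2: "((\<lambda>F. l2_cnj (trunc F (g i))) \<longlongrightarrow> l2_cnj (g i)) (finite_subsets_at_top UNIV)"
      by (rule Lim_transform_eventually[OF trunc_tendsto])
        (use fin in eventually_elim, simp add: l2_cnj_trunc)
    \<comment> \<open>Both arguments of \<open>cinner\<close> vary with \<open>F\<close>. The change
      in the first one is split off and bounded by Cauchy-Schwarz, leaving a limit in the second
      argument alone.\<close>
    have "((\<lambda>F. cinner (T (trunc F (f i)) - T (f i)) (l2_cnj (trunc F (g i)))) \<longlongrightarrow> 0)
      (finite_subsets_at_top UNIV)"
    proof (rule Lim_null_comparison)
      show "\<forall>\<^sub>F F in finite_subsets_at_top UNIV.
        norm (cinner (T (trunc F (f i)) - T (f i)) (l2_cnj (trunc F (g i))))
        \<le> norm (T (trunc F (f i)) - T (f i)) * norm (l2_cnj (trunc F (g i)))"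
        by (simp add: cinner_bound)
      have "((\<lambda>F. norm (T (trunc F (f i)) - T (f i)) * norm (l2_cnj (trunc F (g i)))) \<longlongrightarrow>
        norm (T (f i) - T (f i)) * norm (l2_cnj (g i))) (finite_subsets_at_top UNIV)"
        by (intro tendsto_intros 1 2)
      then show "((\<lambda>F. norm (T (trunc F (f i)) - T (f i)) * norm (l2_cnj (trunc F (g i)))) \<longlongrightarrow> 0)
        (finite_subsets_at_top UNIV)" by simp
    qed
    moreover have "((\<lambda>F. cinner (T (f i)) (l2_cnj (trunc F (g i)))) \<longlongrightarrow>
      cinner (T (f i)) (l2_cnj (g i))) (finite_subsets_at_top UNIV)"
      by (rule bounded_linear.tendsto[OF bounded_linear_cinner_right 2])
    ultimately show ?thesis
      by (auto dest: tendsto_add simp: cinner_diff_left)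
  qed
  \<comment> \<open>Tannery's theorem exchanges the limit over \<open>F\<close> with the series over
    \<open>i\<close>; the dominating series does not depend on \<open>F\<close> because truncation
    does not increase norms.\<close>
  have "((\<lambda>F. \<Sum>i. ?a i F) \<longlongrightarrow> (\<Sum>i. cinner (T (f i)) (l2_cnj (g i)))) (finite_subsets_at_top UNIV)"
    using tannerys_theorem[OF lim ev summable_mult[OF represents_summable_norm[OF r]]] by simp
  moreover have "(\<Sum>i. ?a i F) = (\<Sum>x\<in>F. \<Sum>y\<in>F. h (x, y) * l2_fun (T (ket x)) y)"
    if F: "finite F" for F
  proof -
    have "?a i F = (\<Sum>x\<in>F. \<Sum>y\<in>F. l2_fun (f i) x * l2_fun (g i) y * l2_fun (T (ket x)) y)" for i
    proof -
      have *: "cinner \<zeta> (l2_cnj (trunc F (g i))) = (\<Sum>y\<in>F. l2_fun (g i) y * l2_fun \<zeta> y)" for \<zeta>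
        unfolding l2_cnj_trunc[OF F] unfolding trunc_def
        by (simp add: cinner_scaleC_right cinner_ket_right l2_cnj.rep_eq
            linear_sum[OF bounded_linear.linear[OF bounded_linear_cinner_right]])
      have "?a i F = (\<Sum>x\<in>F. l2_fun (f i) x * cinner (T (ket x)) (l2_cnj (trunc F (g i))))"
        by (simp add: BL2_trunc[OF T] cinner_scaleC_left
            linear_sum[OF bounded_linear.linear[OF bounded_linear_cinner_left]])
      then show ?thesis by (simp only: * sum_distrib_left mult.assoc)
    qed
    moreover have sm: "summable (\<lambda>i. l2_fun (f i) x * l2_fun (g i) y)" for x y
      by (rule summable_comparison_test'[OF represents_summable_norm[OF r]])
        (simp add: norm_mult mult_mono l2_fun_le_norm)
    ultimately have "(\<Sum>i. ?a i F) =
      (\<Sum>x\<in>F. \<Sum>y\<in>F. \<Sum>i. l2_fun (f i) x * l2_fun (g i) y * l2_fun (T (ket x)) y)"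
      by (simp add: suminf_sum summable_sum summable_mult2)
    also have "\<dots> = (\<Sum>x\<in>F. \<Sum>y\<in>F. h (x, y) * l2_fun (T (ket x)) y)"
      using r by (simp add: represents_def suminf_mult2[OF sm, symmetric])
    finally show ?thesis .
  qed
  then have "\<forall>\<^sub>F F in finite_subsets_at_top UNIV.
      (\<Sum>i. ?a i F) = (\<Sum>x\<in>F. \<Sum>y\<in>F. h (x, y) * l2_fun (T (ket x)) y)"
    using fin by (rule eventually_mono[rotated])
  ultimately show ?thesis by (rule Lim_transform_eventually)
qed

lemma tpair_eq:
  assumes T: "T \<in> BL2" and r: "represents f g h"
  shows "tpair T h = (\<Sum>i. cinner (T (f i)) (l2_cnj (g i)))"
  unfolding tpair_def
proof (rule the_equality)
  fix c assume "\<exists>f g. represents f g h \<and> c = (\<Sum>i. cinner (T (f i)) (l2_cnj (g i)))"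
  then obtain f' g' where r': "represents f' g' h"
    and c: "c = (\<Sum>i. cinner (T (f' i)) (l2_cnj (g' i)))" by blast
  show "c = (\<Sum>i. cinner (T (f i)) (l2_cnj (g i)))"
    unfolding c by (rule tendsto_unique[OF finite_subsets_at_top_neq_bot
          represents_pair_tendsto[OF T r'] represents_pair_tendsto[OF T r]])
qed (use r in blast)

lemma tpair_tendsto:
  assumes "T \<in> BL2" and "h \<in> trace_class"
  shows "((\<lambda>F. \<Sum>x\<in>F. \<Sum>y\<in>F. h (x, y) * l2_fun (T (ket x)) y) \<longlongrightarrow> tpair T h)
    (finite_subsets_at_top UNIV)"
proof -
  obtain f g where r: "represents f g h" using assms(2) by (auto simp: trace_class_def)
  show ?thesis unfolding tpair_eq[OF assms(1) r] by (rule represents_pair_tendsto[OF assms(1) r])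
qed

lemma tpair_eqI:
  assumes "T \<in> BL2" "h \<in> trace_class"
    and "((\<lambda>F. \<Sum>x\<in>F. \<Sum>y\<in>F. h (x, y) * l2_fun (T (ket x)) y) \<longlongrightarrow> c) (finite_subsets_at_top UNIV)"
  shows "tpair T h = c"
  by (rule tendsto_unique[OF finite_subsets_at_top_neq_bot tpair_tendsto[OF assms(1,2)] assms(3)])

text \<open>\<open>represents\<close> admits only sequences, so a countable family is padded with
  zeros along \<open>to_nat\<close>. The index types needed below are \<open>nat + nat\<close> for
  sums of kernels and pairs of a group element and a number for \<open>theta\<close>.\<close>

lemma represents_of_countable:
  fixes f g :: "'i :: countable \<Rightarrow> 'a l2"
  assumes f: "(\<lambda>i. (norm (f i))\<^sup>2) summable_on UNIV" and g: "(\<lambda>i. (norm (g i))\<^sup>2) summable_on UNIV"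
    and h: "\<And>x y. ((\<lambda>i. l2_fun (f i) x * l2_fun (g i) y) has_sum h (x, y)) UNIV"
  defines "ext \<equiv> \<lambda>(f :: 'i \<Rightarrow> 'a l2) n. if n \<in> range (to_nat :: 'i \<Rightarrow> nat) then f (from_nat n) else 0"
  shows "represents (ext f) (ext g) h"
proof -
  have 1: "(\<phi> has_sum c) (UNIV :: nat set) \<longleftrightarrow> ((\<lambda>i :: 'i. \<phi> (to_nat i)) has_sum c) UNIV"
    if "\<And>n. n \<notin> range (to_nat :: 'i \<Rightarrow> nat) \<Longrightarrow> \<phi> n = 0"
    for \<phi> :: "nat \<Rightarrow> 'b :: real_normed_vector" and c
  proof -
    have "(\<phi> has_sum c) (UNIV :: nat set) \<longleftrightarrow> (\<phi> has_sum c) (range (to_nat :: 'i \<Rightarrow> nat))"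
      by (rule has_sum_cong_neutral) (use that in auto)
    also have "\<dots> \<longleftrightarrow> ((\<lambda>i :: 'i. \<phi> (to_nat i)) has_sum c) UNIV"
      by (subst has_sum_reindex) (simp_all add: o_def)
    finally show ?thesis .
  qed
  have 2: "summable (\<lambda>n. (norm (ext f n))\<^sup>2)"
    if f: "(\<lambda>i. (norm (f i))\<^sup>2) summable_on UNIV" for f :: "'i \<Rightarrow> 'a l2"
  proof -
    obtain c where "((\<lambda>i. (norm (f i))\<^sup>2) has_sum c) UNIV" using f by (auto simp: summable_on_def)
    then have "((\<lambda>n. (norm (ext f n))\<^sup>2) has_sum c) UNIV" by (subst 1) (auto simp: ext_def)
    then show ?thesis by (auto dest!: has_sum_imp_sums simp: sums_iff)
  qed
  have "((\<lambda>n. l2_fun (ext f n) x * l2_fun (ext g n) y) has_sum h (x, y)) UNIV" for x y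
    using h[of x y] by (subst 1) (auto simp: ext_def l2_fun_simps)
  then show ?thesis
    unfolding represents_def using 2[OF f] 2[OF g] has_sum_imp_sums sums_unique by blast
qed

lemma trace_class_of_countable:
  fixes f g :: "'i :: countable \<Rightarrow> 'a l2"
  assumes "(\<lambda>i. (norm (f i))\<^sup>2) summable_on UNIV" and "(\<lambda>i. (norm (g i))\<^sup>2) summable_on UNIV"
    and "\<And>x y. ((\<lambda>i. l2_fun (f i) x * l2_fun (g i) y) has_sum h (x, y)) UNIV"
  shows "h \<in> trace_class"
  using represents_of_countable[OF assms] unfolding trace_class_def by blast

text \<open>The elementary tensors of the predual. Two basis vectors give a kernel whose pairing
  with \<open>T\<close> is a single matrix entry.\<close>

definition rank_one :: "'a l2 \<Rightarrow> 'a l2 \<Rightarrow> 'a \<times> 'a \<Rightarrow> complex" where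
  "rank_one \<xi> \<eta> = (\<lambda>(x, y). l2_fun \<xi> x * l2_fun \<eta> y)"

lemma represents_rank_one:
  "represents (\<lambda>i. if i = 0 then \<xi> else 0) (\<lambda>i. if i = 0 then \<eta> else 0) (rank_one \<xi> \<eta>)"
proof -
  have *: "summable (\<lambda>i :: nat. (norm (if i = 0 then \<xi> else 0))\<^sup>2)" for \<xi> :: "'a l2"
    by (rule summable_finite[of "{0}"]) auto
  have "(\<Sum>i :: nat. l2_fun (if i = 0 then \<xi> else 0) x * l2_fun (if i = 0 then \<eta> else 0) y) =
    l2_fun \<xi> x * l2_fun \<eta> y" for x y
    by (subst suminf_finite[of "{0}"]) (auto simp: l2_fun_simps)
  with * show ?thesis by (simp add: represents_def rank_one_def)
qed

lemma rank_one_trace_class: "rank_one \<xi> \<eta> \<in> trace_class"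
  using represents_rank_one unfolding trace_class_def by blast

lemma tpair_rank_one:
  assumes "T \<in> BL2"
  shows "tpair T (rank_one \<xi> \<eta>) = cinner (T \<xi>) (l2_cnj \<eta>)"
proof -
  have "T 0 = 0" using BL2_scaleC[OF assms, of 0 0] by (simp add: scaleC_simps)
  then show ?thesis
    unfolding tpair_eq[OF assms represents_rank_one] by (subst suminf_finite[of "{0}"]) auto
qed

lemma tpair_rank_one_ket: "T \<in> BL2 \<Longrightarrow> tpair T (rank_one (ket x) (ket y)) = l2_fun (T (ket x)) y"
  by (simp add: tpair_rank_one cinner_ket_right)

lemma trace_class_scale: "h \<in> trace_class \<Longrightarrow> (\<lambda>p. c * h p) \<in> trace_class"
proof -
  assume "h \<in> trace_class"
  then obtain f g where r: "represents f g h" by (auto simp: trace_class_def)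
  have "summable (\<lambda>i. l2_fun (f i) x * l2_fun (g i) y)" for x y
    by (rule summable_comparison_test'[OF represents_summable_norm[OF r]])
      (simp add: norm_mult mult_mono l2_fun_le_norm)
  then have "represents (\<lambda>i. c *\<^sub>C f i) g (\<lambda>p. c * h p)"
    using r unfolding represents_def
    by (auto simp: norm_scaleC power_mult_distrib l2_fun_simps mult.assoc suminf_mult intro!: summable_mult)
  then show ?thesis by (auto simp: trace_class_def)
qed

lemma has_sum_UNIV_Plus:
  fixes \<phi> :: "'i + 'j \<Rightarrow> 'b :: real_normed_vector"
  assumes "((\<lambda>i. \<phi> (Inl i)) has_sum a) UNIV" and "((\<lambda>j. \<phi> (Inr j)) has_sum b) UNIV"
  shows "(\<phi> has_sum (a + b)) UNIV"
proof -
  have "(\<phi> has_sum a) (range Inl)" "(\<phi> has_sum b) (range Inr)"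
    using assms by (subst has_sum_reindex; simp add: o_def)+
  then have "(\<phi> has_sum (a + b)) (range Inl \<union> range Inr)"
    by (rule has_sum_Un_disjoint) auto
  then show ?thesis by (simp add: UNIV_sum)
qed

text \<open>The two representing families are placed side by side over
  \<open>nat + nat\<close>.\<close>

lemma trace_class_add:
  assumes "h \<in> trace_class" "k \<in> trace_class"
  shows "h + k \<in> trace_class"
proof -
  obtain f g f' g' where r: "represents f g h" and r': "represents f' g' k"
    using assms by (auto simp: trace_class_def)
  have sq: "(\<lambda>i. (norm (case_sum f f' i))\<^sup>2) summable_on UNIV"
    if f: "summable (\<lambda>i. (norm (f i))\<^sup>2)" "summable (\<lambda>i. (norm (f' i))\<^sup>2)"
    for f f' :: "nat \<Rightarrow> 'a l2"
  proof -
    have "(\<lambda>i. (norm (f i))\<^sup>2) summable_on UNIV" "(\<lambda>i. (norm (f' i))\<^sup>2) summable_on UNIV"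
      using f by (auto intro!: norm_summable_imp_summable_on)
    then obtain a b where "((\<lambda>i. (norm (f i))\<^sup>2) has_sum a) UNIV"
      "((\<lambda>i. (norm (f' i))\<^sup>2) has_sum b) UNIV"
      by (auto simp: summable_on_def)
    then have "((\<lambda>i. (norm (case_sum f f' i))\<^sup>2) has_sum (a + b)) UNIV"
      by (intro has_sum_UNIV_Plus) simp_all
    then show ?thesis by (rule has_sum_imp_summable)
  qed
  have sm: "((\<lambda>i. l2_fun (f i) x * l2_fun (g i) y) has_sum h (x, y)) UNIV"
    if r: "represents f g h" for f g h x y
  proof -
    have "summable (\<lambda>i. norm (l2_fun (f i) x * l2_fun (g i) y))"
      by (rule summable_comparison_test'[OF represents_summable_norm[OF r]])
        (simp add: norm_mult mult_mono l2_fun_le_norm)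
    moreover from this have "(\<lambda>i. l2_fun (f i) x * l2_fun (g i) y) sums h (x, y)"
      using r summable_norm_cancel summable_sums unfolding represents_def by fastforce
    ultimately show ?thesis by (rule norm_summable_imp_has_sum)
  qed
  show ?thesis
  proof (rule trace_class_of_countable)
    show "(\<lambda>i. (norm (case_sum f f' i))\<^sup>2) summable_on UNIV"
      "(\<lambda>i. (norm (case_sum g g' i))\<^sup>2) summable_on UNIV"
      using r r' by (intro sq; simp add: represents_def)+
    show "((\<lambda>i. l2_fun (case_sum f f' i) x * l2_fun (case_sum g g' i) y) has_sum (h + k) (x, y)) UNIV"
      for x y
      using has_sum_UNIV_Plus[of "\<lambda>i. l2_fun (case_sum f f' i) x * l2_fun (case_sum g g' i) y"]
        sm[OF r] sm[OF r'] by (simp add: plus_fun_def)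
  qed
qed

text \<open>The finite sums in \<open>tpair_tendsto\<close> are linear both in the kernel and in the
  entries of the operator. This and the following linearity rules pass to the limit there, without
  comparing representations.\<close>

lemma tpair_scale:
  assumes "T \<in> BL2" "h \<in> trace_class"
  shows "tpair T (\<lambda>p. c * h p) = c * tpair T h"
  by (rule tpair_eqI[OF assms(1) trace_class_scale[OF assms(2)]])
    (use tendsto_mult_left[OF tpair_tendsto[OF assms], of c] in
      \<open>simp add: sum_distrib_left mult.assoc\<close>)

lemma tpair_add:
  assumes "T \<in> BL2" "h \<in> trace_class" "k \<in> trace_class"
  shows "tpair T (h + k) = tpair T h + tpair T k"
  by (rule tpair_eqI[OF assms(1) trace_class_add[OF assms(2,3)]])
    (use tendsto_add[OF tpair_tendsto[OF assms(1,2)] tpair_tendsto[OF assms(1,3)]] in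
      \<open>simp add: sum.distrib ring_distribs\<close>)

lemma trace_class_diff: "h \<in> trace_class \<Longrightarrow> k \<in> trace_class \<Longrightarrow> (\<lambda>p. h p - k p) \<in> trace_class"
  using trace_class_add[OF _ trace_class_scale[of k "-1"]] by (simp add: plus_fun_def)

lemma tpair_diff:
  "T \<in> BL2 \<Longrightarrow> h \<in> trace_class \<Longrightarrow> k \<in> trace_class \<Longrightarrow>
    tpair T (\<lambda>p. h p - k p) = tpair T h - tpair T k"
  using tpair_add[OF _ _ trace_class_scale[of k "-1"]] tpair_scale[of T k "-1"]
  by (simp add: plus_fun_def)

lemma tpair_op_scaleC:
  assumes "T \<in> BL2" "h \<in> trace_class"
  shows "tpair (\<lambda>\<xi>. c *\<^sub>C T \<xi>) h = c * tpair T h"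
  by (rule tpair_eqI[OF BL2_op_scaleC[OF assms(1)] assms(2)])
    (use tendsto_mult_left[OF tpair_tendsto[OF assms], of c] in
      \<open>simp add: sum_distrib_left mult_ac l2_fun_simps\<close>)

lemma tpair_op_add:
  assumes "S \<in> BL2" "T \<in> BL2" "h \<in> trace_class"
  shows "tpair (S + T) h = tpair S h + tpair T h"
  by (rule tpair_eqI[OF BL2_plus[OF assms(1,2)] assms(3)])
    (use tendsto_add[OF tpair_tendsto[OF assms(1,3)] tpair_tendsto[OF assms(2,3)]] in
      \<open>simp add: sum.distrib ring_distribs l2_fun_simps\<close>)

lemma tpair_op_zero: "h \<in> trace_class \<Longrightarrow> tpair 0 h = 0"
  by (rule tpair_eqI[OF BL2_zero]) (simp_all add: l2_fun_simps)

lemma trace_class_zero: "(\<lambda>p. 0) \<in> trace_class"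
  using trace_class_scale[OF rank_one_trace_class, of 0] by simp

lemma tpair_zero: "T \<in> BL2 \<Longrightarrow> tpair T (\<lambda>p. 0) = 0"
  by (rule tpair_eqI) (simp_all add: trace_class_zero)

text \<open>Pairing with a matrix unit recovers the value of the kernel at one point.\<close>

lemma trace_class_eqI:
  assumes "\<And>T. T \<in> BL2 \<Longrightarrow> tpair T h = tpair T k" "h \<in> trace_class" "k \<in> trace_class"
  shows "h = k"
proof
  fix p :: "'a \<times> 'a"
  obtain x y where p: "p = (x, y)" by force
  \<comment> \<open>\<open>E\<close> sends \<open>ket x\<close> to \<open>ket y\<close> and every
    other basis vector to 0. The truncated sums are therefore constant as soon as \<open>F\<close>
    contains \<open>x\<close> and \<open>y\<close>.\<close>
  define E where "E = (\<lambda>\<xi>. l2_fun \<xi> x *\<^sub>C ket y)"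
  have E: "E \<in> BL2"
    by (rule BL2_I[where K = 1]) (auto simp: E_def l2_fun_simps norm_scaleC l2_fun_le_norm
        intro!: l2_eqI simp: ring_distribs)
  have *: "((\<lambda>F. \<Sum>x\<in>F. \<Sum>y\<in>F. h (x, y) * l2_fun (E (ket x)) y) \<longlongrightarrow> h p)
    (finite_subsets_at_top UNIV)" for h
  proof (rule tendsto_eventually, unfold eventually_finite_subsets_at_top,
      intro exI[of _ "{x, y}"] conjI allI impI)
    fix F assume F: "finite F \<and> {x, y} \<subseteq> F \<and> F \<subseteq> UNIV"
    have "(\<Sum>x\<in>F. \<Sum>y\<in>F. h (x, y) * l2_fun (E (ket x)) y)
      = (\<Sum>x'\<in>F. if x' = x then \<Sum>y'\<in>F. if y' = y then h (x', y') else 0 else 0)"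
      by (intro sum.cong refl) (auto simp: E_def l2_fun_simps ket.rep_eq intro!: sum.cong)
    also have "\<dots> = h p" using F by (simp add: p)
    finally show "(\<Sum>x\<in>F. \<Sum>y\<in>F. h (x, y) * l2_fun (E (ket x)) y) = h p" .
  qed auto
  show "h p = k p"
    using tpair_eqI[OF E assms(2) *] tpair_eqI[OF E assms(3) *] assms(1)[OF E] by simp
qed

text \<open>After rescaling \<open>T\<close> into the unit ball, its pairing is one of the numbers
  in the supremum \<open>tnorm h\<close>. That supremum is finite because any representation of
  \<open>h\<close> bounds it by the sum of the products of norms.\<close>

lemma tpair_le_tnorm:
  assumes T: "T \<in> BL2" and h: "h \<in> trace_class"
  shows "cmod (tpair T h) \<le> (onorm T + 1) * tnorm h"
proof -
  obtain f g where r: "represents f g h" using h by (auto simp: trace_class_def)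
  have bdd: "bdd_above ((\<lambda>T. cmod (tpair T h)) ` {T \<in> BL2. onorm T \<le> 1})"
  proof (rule bdd_aboveI2)
    fix S :: "'a l2 \<Rightarrow> 'a l2" assume "S \<in> {T \<in> BL2. onorm T \<le> 1}"
    then have S: "S \<in> BL2" "onorm S \<le> 1" by auto
    have b: "cmod (cinner (S (f i)) (l2_cnj (g i))) \<le> norm (f i) * norm (g i)" for i
    proof -
      have "cmod (cinner (S (f i)) (l2_cnj (g i))) \<le> onorm S * (norm (f i) * norm (g i))"
        using cinner_op_bound[OF S(1), of "f i" "l2_cnj (g i)"] by (simp add: norm_l2_cnj)
      also have "\<dots> \<le> 1 * (norm (f i) * norm (g i))" by (intro mult_right_mono S) simp
      finally show ?thesis by simp
    qed
    show "cmod (tpair S h) \<le> (\<Sum>i. norm (f i) * norm (g i))"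
      unfolding tpair_eq[OF S(1) r] by (intro norm_suminf_le b represents_summable_norm[OF r])
  qed
  \<comment> \<open>The added 1 keeps the divisor positive even if \<open>T\<close> is 0.\<close>
  define c where "c = onorm T + 1"
  have c: "c > 0" using onorm_pos_le[OF BL2_bounded_linear[OF T]] by (simp add: c_def)
  let ?S = "\<lambda>\<xi>. complex_of_real (1 / c) *\<^sub>C T \<xi>"
  have "?S \<in> BL2" by (rule BL2_op_scaleC[OF T])
  moreover have "onorm ?S \<le> 1"
  proof (rule onorm_bound)
    fix \<xi>
    have "norm (T \<xi>) \<le> c * norm \<xi>"
      using BL2_norm_le[OF T, of \<xi>] norm_ge_zero[of \<xi>] unfolding c_def distrib_right by linarith
    then show "norm (?S \<xi>) \<le> 1 * norm \<xi>"
      using c by (simp add: norm_scaleC norm_divide field_simps)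
  qed simp
  ultimately have "cmod (tpair ?S h) \<le> tnorm h"
    unfolding tnorm_def by (intro cSUP_upper bdd) simp
  then have "cmod (tpair T h) / c \<le> tnorm h"
    using c by (simp add: tpair_op_scaleC[OF T h] norm_mult norm_divide)
  then show ?thesis using c by (simp add: c_def field_simps)
qed

lemma tnorm_zero: "tnorm (\<lambda>p. 0) = 0"
proof -
  have ne: "{T :: 'a l2 \<Rightarrow> 'a l2. T \<in> BL2 \<and> onorm T \<le> 1} \<noteq> {}"
    using BL2_zero onorm_zero[where 'a = "'a l2" and 'b = "'a l2"]
    by (auto intro!: exI[of _ 0] simp: zero_fun_def)
  have "(\<lambda>T. cmod (tpair T (\<lambda>p. 0))) ` {T :: 'a l2 \<Rightarrow> 'a l2. T \<in> BL2 \<and> onorm T \<le> 1} = {0}"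
    using ne by (auto simp: tpair_zero image_iff)
  then show ?thesis by (simp add: tnorm_def)
qed

section \<open>The weak* topology\<close>

lemma topspace_weak_star: "topspace weak_star = BL2"
proof -
  have "BL2 \<in> {{T \<in> BL2. tpair T h \<in> U} | h U. h \<in> trace_class \<and> open U}"
    using trace_class_zero by (intro CollectI exI[of _ "\<lambda>p. 0"] exI[of _ UNIV]) auto
  then show ?thesis unfolding weak_star_def topology_generated_by_topspace by blast
qed

lemma closedin_weak_star_eq:
  assumes "h \<in> trace_class"
  shows "closedin weak_star {T \<in> BL2. tpair T h = c}"
proof -
  have "openin weak_star {T \<in> BL2. tpair T h \<in> - {c}}"
    unfolding weak_star_def by (rule topology_generated_by_Basis) (use assms in blast)
  moreover have "{T \<in> BL2. tpair T h \<in> - {c}} = BL2 - {T \<in> BL2. tpair T h = c}" by auto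
  ultimately show ?thesis by (simp add: closedin_def topspace_weak_star)
qed

lemma closedin_annihilator:
  assumes "R \<subseteq> trace_class"
  shows "closedin weak_star (annihilator R)"
proof (cases "R = {}")
  case True
  then show ?thesis
    using closedin_topspace[of weak_star] by (simp add: annihilator_def topspace_weak_star)
next
  case False
  then have "annihilator R = (\<Inter>h\<in>R. {T \<in> BL2. tpair T h = 0})" by (auto simp: annihilator_def)
  then show ?thesis using False assms by (auto intro!: closedin_INT closedin_weak_star_eq)
qed

lemma op_subspace_annihilator:
  "R \<subseteq> trace_class \<Longrightarrow> module.subspace (\<lambda>c T \<xi>. c *\<^sub>C T \<xi>) (annihilator R)"
  by (auto simp: module.subspace_def[OF module_operators] annihilator_def BL2_zero BL2_plus
      BL2_op_scaleC tpair_op_zero tpair_op_add tpair_op_scaleC)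

text \<open>An annihilator is a weak* closed subspace. Since \<open>VN\<close> and
  \<open>Bim\<close> are both weak* closures of spans, containment in an annihilator may be checked
  on their generators.\<close>

lemma closure_op_span_subset_annihilator:
  assumes "R \<subseteq> trace_class" "A \<subseteq> annihilator R"
  shows "weak_star closure_of (op_span A) \<subseteq> annihilator R"
  by (intro closure_of_minimal module.span_minimal[OF module_operators] assms
      op_subspace_annihilator closedin_annihilator)

lemma weak_star_closureI:
  assumes T: "T \<in> BL2" and A: "\<forall>\<^sub>F u in F. S u \<in> A" "A \<subseteq> BL2" and F: "F \<noteq> bot"
    and lim: "\<And>h. h \<in> trace_class \<Longrightarrow> ((\<lambda>u. tpair (S u) h) \<longlongrightarrow> tpair T h) F"
  shows "T \<in> weak_star closure_of A"
  unfolding in_closure_of topspace_weak_star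
proof (intro conjI T allI impI)
  fix U assume "T \<in> U \<and> openin weak_star U"
  then have U: "T \<in> U"
    "generate_topology_on {{T \<in> BL2. tpair T h \<in> U} | h U. h \<in> trace_class \<and> open U} U"
    by (simp_all add: weak_star_def openin_topology_generated_by_iff)
  from U(2,1) have "\<forall>\<^sub>F u in F. S u \<in> U"
  \<comment> \<open>Induction over the generation of open sets from the subbasis: finite
    intersections are handled by the filter, and for a union one member containing \<open>T\<close>
    is enough.\<close>
  proof induction
    case (Basis s)
    then obtain h U where s: "s = {T \<in> BL2. tpair T h \<in> U}" "h \<in> trace_class" "open U" by blast
    have "\<forall>\<^sub>F u in F. tpair (S u) h \<in> U"
      using lim[OF s(2)] s Basis(2) by (auto dest: topological_tendstoD)
    then show ?case using A(1) by eventually_elim (use A(2) s in auto)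
  next
    case (UN K)
    then obtain k where k: "k \<in> K" "T \<in> k" by blast
    from UN.IH[OF k] show ?case by (rule eventually_mono) (use k in auto)
  qed (auto intro: eventually_conj)
  with A(1) have "\<forall>\<^sub>F u in F. S u \<in> A \<and> S u \<in> U" by (rule eventually_conj)
  then show "\<exists>y. y \<in> A \<and> y \<in> U" using eventually_happens F by blast
qed

text \<open>The series for \<open>tpair\<close> also converges as an unordered sum, the form in
  which it can be interchanged with the sum over the group.\<close>

lemma tpair_has_sum:
  assumes T: "T \<in> BL2" and r: "represents f g h"
  shows "((\<lambda>i. cinner (T (f i)) (l2_cnj (g i))) has_sum tpair T h) UNIV"
proof (rule norm_summable_imp_has_sum)
  show "summable (\<lambda>i. norm (cinner (T (f i)) (l2_cnj (g i))))"
  proof (rule summable_comparison_test'[OF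
        summable_mult[OF represents_summable_norm[OF r], of "onorm T"]])
    show "norm (norm (cinner (T (f i)) (l2_cnj (g i)))) \<le> onorm T * (norm (f i) * norm (g i))" for i
      using cinner_op_bound[OF T, of "f i" "l2_cnj (g i)"] by (simp add: norm_l2_cnj)
  qed
  show "(\<lambda>i. cinner (T (f i)) (l2_cnj (g i))) sums tpair T h"
    using represents_summable_cinner[OF r T] by (simp add: tpair_eq[OF T r] summable_sums)
qed

lemma tpair_has_sum_countable:
  fixes f g :: "'i :: countable \<Rightarrow> 'a l2"
  assumes f: "(\<lambda>i. (norm (f i))\<^sup>2) summable_on UNIV" and g: "(\<lambda>i. (norm (g i))\<^sup>2) summable_on UNIV"
    and h: "\<And>x y. ((\<lambda>i. l2_fun (f i) x * l2_fun (g i) y) has_sum h (x, y)) UNIV"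
    and T: "T \<in> BL2"
  shows "((\<lambda>i. cinner (T (f i)) (l2_cnj (g i))) has_sum tpair T h) UNIV"
proof -
  define ext where
    "ext \<equiv> \<lambda>(f :: 'i \<Rightarrow> 'a l2) n. if n \<in> range (to_nat :: 'i \<Rightarrow> nat) then f (from_nat n) else 0"
  have r: "represents (ext f) (ext g) h"
    unfolding ext_def by (rule represents_of_countable[OF f g h])
  have T0: "T 0 = 0" using BL2_scaleC[OF T, of 0 0] by (simp add: scaleC_simps)
  let ?a = "\<lambda>n. cinner (T (ext f n)) (l2_cnj (ext g n))"
  have "(?a has_sum tpair T h) UNIV" by (rule tpair_has_sum[OF T r])
  also have "?this \<longleftrightarrow> (?a has_sum tpair T h) (range (to_nat :: 'i \<Rightarrow> nat))"
    by (rule has_sum_cong_neutral) (auto simp: ext_def T0)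
  also have "\<dots> \<longleftrightarrow> ((\<lambda>i :: 'i. ?a (to_nat i)) has_sum tpair T h) UNIV"
    by (subst has_sum_reindex) (simp_all add: o_def)
  finally show ?thesis by (simp add: ext_def)
qed

section \<open>The action of \<open>L\<^sup>1(G)\<close> on operators and on the trace class\<close>

lemma bij_add_right: "bij (\<lambda>s :: 'g :: group_add. s + r)"
  by (rule bij_betwI[where g = "\<lambda>t. t - r"]) simp_all

lemma bij_add_left: "bij (\<lambda>s :: 'g :: group_add. r + s)"
  by (rule bij_betwI[where g = "\<lambda>t. - r + t"]) (simp_all add: add.assoc[symmetric])

lemma cinner_rho: "cinner (rho r \<xi>) \<eta> = cinner \<xi> (rho (- r) \<eta>)"
  using infsum_reindex_bij_betw[OF bij_add_right[of r], of "\<lambda>s. l2_fun \<xi> s * cnj (l2_fun \<eta> (s - r))"]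
  by (simp add: cinner_def rho.rep_eq)

lemma cinner_lam: "cinner (lam r \<xi>) \<eta> = cinner \<xi> (lam (- r) \<eta>)"
  using infsum_reindex_bij_betw[OF bij_add_left[of "- r"], of "\<lambda>s. l2_fun \<xi> s * cnj (l2_fun \<eta> (r + s))"]
  by (simp add: cinner_def lam.rep_eq add.assoc[symmetric])

lemma norm_rho [simp]: "norm (rho r \<xi>) = norm \<xi>"
  using infsum_reindex_bij_betw[OF bij_add_right[of r], of "\<lambda>s. (cmod (l2_fun \<xi> s))\<^sup>2"]
  by (simp add: norm_l2_def rho.rep_eq)

lemma norm_lam [simp]: "norm (lam r \<xi>) = norm \<xi>"
  using infsum_reindex_bij_betw[OF bij_add_left[of "- r"], of "\<lambda>s. (cmod (l2_fun \<xi> s))\<^sup>2"]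
  by (simp add: norm_l2_def lam.rep_eq)

lemma BL2_rho: "rho r \<in> BL2"
  by (rule BL2_I[where K = 1]) (auto intro!: l2_eqI simp: rho.rep_eq l2_fun_simps)

lemma BL2_lam: "lam r \<in> BL2"
  by (rule BL2_I[where K = 1]) (auto intro!: l2_eqI simp: lam.rep_eq l2_fun_simps)

lemma rho_ket: "rho r (ket t) = ket (t - r)"
  by (rule l2_eqI) (simp add: rho.rep_eq ket.rep_eq eq_diff_eq)

lemma lam_ket: "lam r (ket t) = ket (r + t)"
proof (rule l2_eqI)
  have "- r + x = t \<longleftrightarrow> x = r + t" for x by (metis add.assoc left_minus right_minus add_0)
  then show "l2_fun (lam r (ket t)) x = l2_fun (ket (r + t)) x" for x
    by (simp add: lam.rep_eq ket.rep_eq)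
qed

lemma lam_lam: "lam r (lam s \<xi>) = lam (r + s) \<xi>"
  by (rule l2_eqI) (simp only: lam.rep_eq minus_add add.assoc)

lemma l2_cnj_rho: "l2_cnj (rho r \<xi>) = rho r (l2_cnj \<xi>)"
  by (rule l2_eqI) (simp add: rho.rep_eq l2_cnj.rep_eq)

lemma adj_eqI:
  assumes "\<And>\<xi> \<eta>. cinner (T \<xi>) \<eta> = cinner \<xi> (S \<eta>)"
  shows "adj T = S"
  unfolding adj_def
proof (rule the_equality)
  fix S' assume S': "\<forall>\<xi> \<eta>. cinner (T \<xi>) \<eta> = cinner \<xi> (S' \<eta>)"
  show "S' = S"
  proof
    fix \<eta>
    have "cinner (ket x) (S' \<eta>) = cinner (ket x) (S \<eta>)" for x
      using S' assms by metis
    then have "cinner (S' \<eta>) (ket x) = cinner (S \<eta>) (ket x)" for x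
      by (metis cinner_commute)
    then show "S' \<eta> = S \<eta>" by (intro l2_eqI) (simp add: cinner_ket_right)
  qed
qed (use assms in blast)

lemma adj_rho: "adj (rho r) = rho (- r)"
  by (rule adj_eqI) (rule cinner_rho)

text \<open>The conjugation \<open>rho r \<circ> T \<circ> adj (rho r)\<close> from
  \<open>Theta\<close>, with the adjoint replaced by its value from \<open>adj_rho\<close>.\<close>

definition conj_rho :: "'g :: group_add \<Rightarrow> ('g l2 \<Rightarrow> 'g l2) \<Rightarrow> 'g l2 \<Rightarrow> 'g l2" where
  "conj_rho r T = rho r \<circ> T \<circ> rho (- r)"

lemma BL2_conj_rho: "T \<in> BL2 \<Longrightarrow> conj_rho r T \<in> BL2"
  unfolding conj_rho_def by (intro BL2_compose BL2_rho)

lemma norm_conj_rho_le: "T \<in> BL2 \<Longrightarrow> norm (conj_rho r T \<xi>) \<le> onorm T * norm \<xi>"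
  using BL2_norm_le[of T "rho (- r) \<xi>"] by (simp add: conj_rho_def)

lemma conj_rho_entry: "l2_fun (conj_rho r T (ket t)) s = l2_fun (T (ket (t + r))) (s + r)"
  by (simp add: conj_rho_def rho_ket rho.rep_eq)

lemma summable_on_times:
  fixes a :: "'i \<Rightarrow> real" and b :: "'j \<Rightarrow> real"
  assumes a: "a summable_on UNIV" "\<And>i. a i \<ge> 0" and b: "b summable_on UNIV" "\<And>j. b j \<ge> 0"
  shows "(\<lambda>(i, j). a i * b j) summable_on UNIV"
proof -
  have "(\<lambda>(i, j). a i * b j) summable_on (UNIV \<times> UNIV)"
  proof (rule summable_on_SigmaI)
    show "((\<lambda>j. case (i, j) of (i, j) \<Rightarrow> a i * b j) has_sum a i * infsum b UNIV) UNIV" for i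
      using b by (auto intro!: has_sum_cmult_right has_sum_infsum)
    show "(\<lambda>i. a i * infsum b UNIV) summable_on UNIV" by (rule summable_on_cmult_left[OF a(1)])
  qed (use a b in auto)
  then show ?thesis by simp
qed

text \<open>The scalar \<open>f r\<close> is split as \<open>csqrt (f r) * csqrt (f r)\<close> between the two legs of \<open>h\<close>, so that both
  families of vectors stay square summable.\<close>

lemma theta_kernel_exists:
  fixes f :: "'g :: {countable, group_add} \<Rightarrow> complex"
  assumes f: "f \<in> L1" and r: "represents F G h"
  obtains k where "k \<in> trace_class"
    and "\<And>T. T \<in> BL2 \<Longrightarrow>
      ((\<lambda>(r, i). f r * cinner (conj_rho r T (F i)) (l2_cnj (G i))) has_sum tpair T k) UNIV"
proof -
  define S where "S F = (\<lambda>(r, i :: nat). csqrt (f r) *\<^sub>C rho (- r) (F i))" for F :: "nat \<Rightarrow> 'g l2"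
  have sq: "(\<lambda>p. (norm (S F p))\<^sup>2) summable_on UNIV" if F: "summable (\<lambda>i. (norm (F i))\<^sup>2)" for F
  proof -
    have "(\<lambda>(r, i). cmod (f r) * (norm (F i))\<^sup>2) summable_on UNIV"
      using f F by (intro summable_on_times norm_summable_imp_summable_on) (auto simp: L1_def)
    also have "(\<lambda>(r, i). cmod (f r) * (norm (F i))\<^sup>2) = (\<lambda>p. (norm (S F p))\<^sup>2)"
      by (auto simp: S_def norm_scaleC power_mult_distrib norm_power[symmetric])
    finally show ?thesis .
  qed
  have F: "(\<lambda>p. (norm (S F p))\<^sup>2) summable_on UNIV" and G: "(\<lambda>p. (norm (S G p))\<^sup>2) summable_on UNIV"
    using r by (auto intro!: sq simp: represents_def)
  define k where "k = (\<lambda>(x, y). \<Sum>\<^sub>\<infinity>p. l2_fun (S F p) x * l2_fun (S G p) y)"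
  have k: "((\<lambda>p. l2_fun (S F p) x * l2_fun (S G p) y) has_sum k (x, y)) UNIV" for x y
  proof -
    have "(\<lambda>p. l2_fun (S F p) x * l2_fun (S G p) y) summable_on UNIV"
    proof (rule abs_summable_summable, rule summable_on_comparison_test)
      show "(\<lambda>p. (norm (S F p))\<^sup>2 + (norm (S G p))\<^sup>2) summable_on UNIV"
        by (rule summable_on_add[OF F G])
      show "norm (l2_fun (S F p) x * l2_fun (S G p) y) \<le> (norm (S F p))\<^sup>2 + (norm (S G p))\<^sup>2" for p
      proof -
        have "norm (l2_fun (S F p) x * l2_fun (S G p) y) \<le> norm (S F p) * norm (S G p)"
          by (simp add: norm_mult mult_mono l2_fun_le_norm)
        moreover have "2 * (norm (S F p) * norm (S G p)) \<le> (norm (S F p))\<^sup>2 + (norm (S G p))\<^sup>2"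
          using sum_squares_bound[of "norm (S F p)" "norm (S G p)"] by (simp add: mult.assoc)
        moreover have "0 \<le> norm (S F p) * norm (S G p)" by simp
        ultimately show ?thesis by linarith
      qed
    qed simp
    then show ?thesis by (simp add: k_def)
  qed
  have "k \<in> trace_class" by (rule trace_class_of_countable[OF F G k])
  moreover have "((\<lambda>(r, i). f r * cinner (conj_rho r T (F i)) (l2_cnj (G i))) has_sum tpair T k) UNIV"
    if T: "T \<in> BL2" for T
  proof -
    \<comment> \<open>\<open>l2_cnj\<close> conjugates the scalar on the second leg and the
      conjugate-linear slot of \<open>cinner\<close> undoes this, so the two square roots multiply
      to \<open>f r\<close>. Moving \<open>rho (- r)\<close> across \<open>cinner\<close> produces
      the conjugation of \<open>T\<close>.\<close>
    have "cinner (T (S F (r, i))) (l2_cnj (S G (r, i))) =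
      (csqrt (f r))\<^sup>2 * cinner (conj_rho r T (F i)) (l2_cnj (G i))" for r i
      by (simp add: S_def l2_cnj_scaleC BL2_scaleC[OF T] cinner_scaleC_left cinner_scaleC_right
          l2_cnj_rho conj_rho_def cinner_rho power2_eq_square)
    then have "(\<lambda>p. cinner (T (S F p)) (l2_cnj (S G p))) =
      (\<lambda>(r, i). f r * cinner (conj_rho r T (F i)) (l2_cnj (G i)))"
      by auto
    with tpair_has_sum_countable[OF F G k T] show ?thesis by simp
  qed
  ultimately show thesis by (rule that)
qed

text \<open>The operator is summed vector by vector: conjugation by \<open>rho r\<close> does not
  raise the norm bound of \<open>T\<close> and \<open>f\<close> is summable, so the series converges
  absolutely.\<close>

lemma Theta_exists:
  fixes f :: "'g :: {countable, group_add} \<Rightarrow> complex"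
  assumes f: "f \<in> L1" and T: "T \<in> BL2"
  obtains S where "S \<in> BL2" and "\<And>\<xi> \<eta>. cinner (S \<xi>) \<eta> = (\<Sum>\<^sub>\<infinity>r. f r * cinner (conj_rho r T \<xi>) \<eta>)"
proof -
  define S where "S \<xi> = (\<Sum>\<^sub>\<infinity>r. f r *\<^sub>C conj_rho r T \<xi>)" for \<xi>
  have bound: "norm (f r *\<^sub>C conj_rho r T \<xi>) \<le> cmod (f r) * (onorm T * norm \<xi>)" for r \<xi>
    unfolding norm_scaleC by (intro mult_left_mono norm_conj_rho_le T) simp
  have sm1: "(\<lambda>r. cmod (f r) * (onorm T * norm \<xi>)) summable_on UNIV" for \<xi> :: "'g l2"
    using f by (intro summable_on_cmult_left) (simp add: L1_def)
  have abs: "(\<lambda>r. f r *\<^sub>C conj_rho r T \<xi>) abs_summable_on UNIV" for \<xi>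
    by (rule summable_on_comparison_test[OF sm1]) (auto intro: bound)
  have S: "((\<lambda>r. f r *\<^sub>C conj_rho r T \<xi>) has_sum S \<xi>) UNIV" for \<xi>
    unfolding S_def by (rule has_sum_infsum[OF abs_summable_summable[OF abs]])
  have "S \<in> BL2"
  proof (rule BL2_I[where K = "L1_norm f * onorm T"])
    show "S (\<xi> + \<eta>) = S \<xi> + S \<eta>" for \<xi> \<eta>
      using has_sum_add[OF S[of \<xi>] S[of \<eta>]] S[of "\<xi> + \<eta>"]
      by (simp add: BL2_add[OF BL2_conj_rho[OF T]] scaleC_simps has_sum_unique)
    show "S (c *\<^sub>C \<xi>) = c *\<^sub>C S \<xi>" for c \<xi>
    proof -
      have "bounded_linear ((*\<^sub>C) c :: 'g l2 \<Rightarrow> _)"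
        by (rule bounded_linear_intro[where K = "cmod c"])
          (simp_all add: scaleC_simps norm_scaleC mult.commute)
      from has_sum_bounded_linear[OF this S[of \<xi>]] S[of "c *\<^sub>C \<xi>"] show ?thesis
        by (simp add: BL2_scaleC[OF BL2_conj_rho[OF T]] scaleC_simps mult.commute has_sum_unique)
    qed
    show "norm (S \<xi>) \<le> norm \<xi> * (L1_norm f * onorm T)" for \<xi>
    proof -
      have "norm (S \<xi>) \<le> (\<Sum>\<^sub>\<infinity>r. norm (f r *\<^sub>C conj_rho r T \<xi>))"
        unfolding S_def by (rule norm_infsum_bound[OF abs])
      also have "\<dots> \<le> (\<Sum>\<^sub>\<infinity>r. cmod (f r) * (onorm T * norm \<xi>))"
        by (rule infsum_mono[OF abs sm1 bound])
      also have "\<dots> = L1_norm f * (onorm T * norm \<xi>)"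
        unfolding L1_norm_def using f by (subst infsum_cmult_left) (auto simp: L1_def)
      finally show ?thesis by (simp add: mult_ac)
    qed
  qed
  moreover have "cinner (S \<xi>) \<eta> = (\<Sum>\<^sub>\<infinity>r. f r * cinner (conj_rho r T \<xi>) \<eta>)" for \<xi> \<eta>
    using has_sum_bounded_linear[OF bounded_linear_cinner_left[of \<eta>] S[of \<xi>]]
    by (simp add: cinner_scaleC_left infsumI)
  ultimately show thesis by (rule that)
qed

text \<open>The operator of \<open>Theta_exists\<close> satisfies the description in
  \<open>Theta\<close>: its pairing formula is an interchange of sums over the group and over a
  representation of \<open>h\<close>. Matrix entries give uniqueness.\<close>

lemma Theta_props:
  fixes f :: "'g :: {countable, group_add} \<Rightarrow> complex"
  assumes f: "f \<in> L1" and T: "T \<in> BL2"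
  shows Theta_BL2: "Theta f T \<in> BL2"
    and tpair_Theta: "\<And>h. h \<in> trace_class \<Longrightarrow>
      tpair (Theta f T) h = (\<Sum>\<^sub>\<infinity>r. f r * tpair (conj_rho r T) h)"
proof -
  obtain S where S: "S \<in> BL2"
    and S_cinner: "\<And>\<xi> \<eta>. cinner (S \<xi>) \<eta> = (\<Sum>\<^sub>\<infinity>r. f r * cinner (conj_rho r T \<xi>) \<eta>)"
    by (rule Theta_exists[OF f T]) blast
  have S_tpair: "tpair S h = (\<Sum>\<^sub>\<infinity>r. f r * tpair (conj_rho r T) h)" if h: "h \<in> trace_class" for h
  proof -
    obtain F G where r: "represents F G h" using h by (auto simp: trace_class_def)
    let ?a = "\<lambda>r i. f r * cinner (conj_rho r T (F i)) (l2_cnj (G i))"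
    \<comment> \<open>Here \<open>k\<close> serves only as a source of summability of the double
      family, which licenses the interchange.\<close>
    obtain k where "((\<lambda>(r, i). ?a r i) has_sum tpair T k) UNIV"
      using theta_kernel_exists[OF f r] T by blast
    then have sm: "(\<lambda>(r, i). ?a r i) summable_on UNIV \<times> UNIV"
      by (simp add: has_sum_imp_summable)
    have "tpair S h = (\<Sum>\<^sub>\<infinity>i. \<Sum>\<^sub>\<infinity>r. ?a r i)"
      by (simp add: infsumI[OF tpair_has_sum[OF S r], symmetric] S_cinner)
    also have "\<dots> = (\<Sum>\<^sub>\<infinity>r. \<Sum>\<^sub>\<infinity>i. ?a r i)" by (rule infsum_swap_banach[OF sm, symmetric])
    also have "\<dots> = (\<Sum>\<^sub>\<infinity>r. f r * tpair (conj_rho r T) h)"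
      using infsumI[OF has_sum_cmult_right[OF tpair_has_sum[OF BL2_conj_rho[OF T] r]]] by simp
    finally show ?thesis .
  qed
  have "Theta f T = S"
    unfolding Theta_def adj_rho conj_rho_def[symmetric]
  proof (rule the_equality)
    show "S \<in> BL2 \<and> (\<forall>h\<in>trace_class. tpair S h = (\<Sum>\<^sub>\<infinity>r. f r * tpair (conj_rho r T) h))"
      using S S_tpair by blast
    fix S' assume S': "S' \<in> BL2 \<and>
      (\<forall>h\<in>trace_class. tpair S' h = (\<Sum>\<^sub>\<infinity>r. f r * tpair (conj_rho r T) h))"
    show "S' = S"
    proof (rule BL2_eqI)
      show "l2_fun (S' (ket y)) x = l2_fun (S (ket y)) x" for x y
        using S' S S_tpair rank_one_trace_class
          tpair_rank_one_ket[of S' y x] tpair_rank_one_ket[of S y x] by metis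
    qed (use S S' in auto)
  qed
  with S S_tpair show "Theta f T \<in> BL2" and "\<And>h. h \<in> trace_class \<Longrightarrow>
      tpair (Theta f T) h = (\<Sum>\<^sub>\<infinity>r. f r * tpair (conj_rho r T) h)"
    by simp_all
qed

lemma Theta_entry:
  fixes f :: "'g :: {countable, group_add} \<Rightarrow> complex"
  assumes "f \<in> L1" "T \<in> BL2"
  shows "l2_fun (Theta f T (ket t)) s = (\<Sum>\<^sub>\<infinity>r. f r * l2_fun (T (ket (t + r))) (s + r))"
  using tpair_Theta[OF assms rank_one_trace_class, of "ket t" "ket s"]
  by (simp add: tpair_rank_one_ket Theta_BL2 BL2_conj_rho conj_rho_entry assms)

text \<open>The kernel from \<open>theta_kernel_exists\<close> is the preadjoint image of
  \<open>h\<close>: summing its double series first over the representation and then over the group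
  gives the formula for \<open>Theta f T\<close>. \<open>trace_class_eqI\<close> gives
  uniqueness.\<close>

lemma theta_props:
  fixes f :: "'g :: {countable, group_add} \<Rightarrow> complex"
  assumes f: "f \<in> L1" and h: "h \<in> trace_class"
  shows theta_trace_class: "theta f h \<in> trace_class"
    and tpair_theta: "\<And>T. T \<in> BL2 \<Longrightarrow> tpair T (theta f h) = tpair (Theta f T) h"
proof -
  obtain F G where r: "represents F G h" using h by (auto simp: trace_class_def)
  let ?a = "\<lambda>T r i. f r * cinner (conj_rho r T (F i)) (l2_cnj (G i))"
  obtain k where k: "k \<in> trace_class"
    and has: "\<And>T. T \<in> BL2 \<Longrightarrow> ((\<lambda>(r, i). ?a T r i) has_sum tpair T k) UNIV"
    using theta_kernel_exists[OF f r] by blast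
  have k_tpair: "tpair T k = tpair (Theta f T) h" if T: "T \<in> BL2" for T
  proof -
    have "(\<lambda>(r, i). ?a T r i) summable_on (UNIV \<times> UNIV)"
      using has[OF T] by (simp add: has_sum_imp_summable)
    from infsum_Sigma'_banach[OF this] have "tpair T k = (\<Sum>\<^sub>\<infinity>r. \<Sum>\<^sub>\<infinity>i. ?a T r i)"
      using has[OF T] by (simp add: infsumI)
    also have "\<dots> = (\<Sum>\<^sub>\<infinity>r. f r * tpair (conj_rho r T) h)"
      using infsumI[OF has_sum_cmult_right[OF tpair_has_sum[OF BL2_conj_rho[OF T] r]]] by simp
    finally show ?thesis by (simp add: tpair_Theta[OF f T h])
  qed
  have "theta f h = k"
    unfolding theta_def
    by (rule the_equality) (use k k_tpair in \<open>auto intro!: trace_class_eqI\<close>)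
  with k k_tpair show "theta f h \<in> trace_class"
    and "\<And>T. T \<in> BL2 \<Longrightarrow> tpair T (theta f h) = tpair (Theta f T) h"
    by simp_all
qed

section \<open>The annihilator of \<open>Ran J\<close> contains the bimodule\<close>

lemma Ran_subset_trace_class: "Ran J \<subseteq> trace_class"
  by (auto simp: Ran_def)

lemma fun_span_tpair_zero:
  assumes "T \<in> BL2" and "A \<subseteq> {k \<in> trace_class. tpair T k = 0}"
  shows "fun_span A \<subseteq> {k \<in> trace_class. tpair T k = 0}"
proof (rule module.span_minimal[OF module_functions assms(2)])
  show "fun_subspace {k \<in> trace_class. tpair T k = 0}"
    using assms(1)
    by (auto simp: module.subspace_def[OF module_functions] trace_class_add trace_class_scale
        tpair_add tpair_scale zero_fun_def trace_class_zero tpair_zero)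
qed

text \<open>Passing to the closed linear span does not change the annihilator: each generator lies
  in \<open>Ran J\<close>, and pairing with \<open>T\<close> is linear and continuous for
  \<open>tnorm\<close>.\<close>

lemma annihilator_Ran_iff:
  fixes J :: "('g :: {countable, group_add} \<Rightarrow> complex) set"
  assumes J: "J \<subseteq> L1"
  shows "T \<in> annihilator (Ran J) \<longleftrightarrow>
    T \<in> BL2 \<and> (\<forall>f\<in>J. \<forall>h\<in>trace_class. tpair T (theta f h) = 0)" (is "_ \<longleftrightarrow> ?R")
proof
  let ?A = "{theta f h' | f h'. f \<in> J \<and> h' \<in> trace_class}"
  assume T: "T \<in> annihilator (Ran J)"
  have "theta f h \<in> Ran J" if "f \<in> J" "h \<in> trace_class" for f h
    unfolding Ran_def
  proof (intro CollectI conjI allI impI)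
    fix e :: real assume "e > 0"
    moreover have "theta f h \<in> fun_span ?A"
      by (rule module.span_base[OF module_functions]) (use that in blast)
    ultimately show "\<exists>k\<in>fun_span ?A. tnorm (\<lambda>p. theta f h p - k p) < e"
      by (intro bexI[of _ "theta f h"]) (simp_all add: tnorm_zero)
  qed (use J that theta_trace_class in blast)
  with T show ?R by (auto simp: annihilator_def)
next
  let ?A = "{theta f h' | f h'. f \<in> J \<and> h' \<in> trace_class}"
  assume R: ?R
  then have T: "T \<in> BL2" by blast
  have span: "fun_span ?A \<subseteq> {k \<in> trace_class. tpair T k = 0}"
    by (rule fun_span_tpair_zero[OF T]) (use R J theta_trace_class in blast)
  have "tpair T h = 0" if h: "h \<in> Ran J" for h
  proof -
    define K where "K = onorm T + 1"
    have K: "K > 0" using onorm_pos_le[OF BL2_bounded_linear[OF T]] by (simp add: K_def)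
    have ht: "h \<in> trace_class" using h Ran_subset_trace_class by blast
    have "cmod (tpair T h) \<le> 0 + e" if e: "e > 0" for e
    proof -
      obtain k where k: "k \<in> fun_span ?A" "tnorm (\<lambda>p. h p - k p) < e / K"
        using h e K unfolding Ran_def by (auto dest!: spec[of _ "e / K"])
      then have kt: "k \<in> trace_class" "tpair T k = 0" using span by auto
      have "cmod (tpair T h) = cmod (tpair T (\<lambda>p. h p - k p))"
        by (simp add: tpair_diff T ht kt)
      also have "\<dots> \<le> K * tnorm (\<lambda>p. h p - k p)"
        unfolding K_def by (rule tpair_le_tnorm[OF T trace_class_diff[OF ht kt(1)]])
      also have "\<dots> \<le> K * (e / K)" using k K by (intro mult_left_mono) auto
      finally show ?thesis using K by simp
    qed
    then have "cmod (tpair T h) \<le> 0" by (rule field_le_epsilon)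
    then show ?thesis by simp
  qed
  with T show "T \<in> annihilator (Ran J)" by (simp add: annihilator_def)
qed

text \<open>By duality the condition says that \<open>Theta f T\<close> pairs to 0 with every
  kernel, that is, all its entries vanish. Each entry is the sum of \<open>f\<close> against one
  diagonal of \<open>T\<close>.\<close>

lemma annihilator_Ran_iff_entries:
  fixes J :: "('g :: {countable, group_add} \<Rightarrow> complex) set"
  assumes J: "J \<subseteq> L1"
  shows "T \<in> annihilator (Ran J) \<longleftrightarrow>
    T \<in> BL2 \<and> (\<forall>f\<in>J. \<forall>s t. (\<Sum>\<^sub>\<infinity>r. f r * l2_fun (T (ket (t + r))) (s + r)) = 0)"
  unfolding annihilator_Ran_iff[OF J]
proof (intro conj_cong refl ball_cong)
  fix f assume T: "T \<in> BL2" and "f \<in> J"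
  then have f: "f \<in> L1" using J by blast
  show "(\<forall>h\<in>trace_class. tpair T (theta f h) = 0) \<longleftrightarrow>
    (\<forall>s t. (\<Sum>\<^sub>\<infinity>r. f r * l2_fun (T (ket (t + r))) (s + r)) = 0)"
    (is "_ \<longleftrightarrow> ?R")
  proof
    assume "\<forall>h\<in>trace_class. tpair T (theta f h) = 0"
    then have "tpair (Theta f T) (rank_one (ket t) (ket s)) = 0" for s t
      using tpair_theta[OF f _ T] rank_one_trace_class by metis
    then show ?R by (simp add: tpair_rank_one_ket Theta_BL2[OF f T] Theta_entry[OF f T])
  next
    assume ?R
    then have "Theta f T = 0"
      by (intro BL2_eqI Theta_BL2[OF f T] BL2_zero) (simp add: Theta_entry[OF f T] l2_fun_simps)
    then show "\<forall>h\<in>trace_class. tpair T (theta f h) = 0"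
      by (simp add: tpair_theta[OF f _ T] tpair_op_zero)
  qed
qed

section \<open>Multiplication operators, translation of ideals, and the generators of the
  bimodule\<close>

lemma BL2_mult_op:
  assumes a: "a \<in> Linfty"
  shows "mult_op a \<in> BL2"
proof -
  obtain C where C: "\<And>x. cmod (a x) \<le> C"
    using a unfolding Linfty_def bounded_iff by auto
  have C0: "C \<ge> 0" using C[of undefined] norm_ge_zero order_trans by blast
  show ?thesis
  proof (rule BL2_I[where K = C])
    fix \<xi> \<eta> c
    show "mult_op a (\<xi> + \<eta>) = mult_op a \<xi> + mult_op a \<eta>"
      by (rule l2_eqI) (simp add: l2_fun_mult_op[OF a] l2_fun_simps ring_distribs)
    show "mult_op a (c *\<^sub>C \<xi>) = c *\<^sub>C mult_op a \<xi>"
      by (rule l2_eqI) (simp add: l2_fun_mult_op[OF a] l2_fun_simps)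
    show "norm (mult_op a \<xi>) \<le> norm \<xi> * C"
    proof (rule norm_l2_leI)
      fix F :: "'a set" assume F: "finite F"
      have "(\<Sum>x\<in>F. (cmod (l2_fun (mult_op a \<xi>) x))\<^sup>2) \<le> (\<Sum>x\<in>F. C\<^sup>2 * (cmod (l2_fun \<xi> x))\<^sup>2)"
        using C by (intro sum_mono)
          (auto simp: l2_fun_mult_op[OF a] norm_mult power_mult_distrib intro!: mult_right_mono power_mono)
      also have "\<dots> \<le> C\<^sup>2 * (norm \<xi>)\<^sup>2"
        unfolding sum_distrib_left[symmetric] by (intro mult_left_mono sum_le_norm_l2 F) simp
      finally show "(\<Sum>x\<in>F. (cmod (l2_fun (mult_op a \<xi>) x))\<^sup>2) \<le> (norm \<xi> * C)\<^sup>2"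
        by (simp add: power_mult_distrib mult.commute)
    qed (use C0 in simp)
  qed
qed

lemma cnj_Linfty: "a \<in> Linfty \<Longrightarrow> (\<lambda>x. cnj (a x)) \<in> Linfty"
  by (simp add: Linfty_def bounded_iff)

lemma cinner_mult_op:
  "a \<in> Linfty \<Longrightarrow> cinner (mult_op a \<xi>) \<eta> = cinner \<xi> (mult_op (\<lambda>x. cnj (a x)) \<eta>)"
  by (simp add: cinner_def l2_fun_mult_op cnj_Linfty mult_ac)

lemma convolve_delta: "convolve (\<lambda>t. of_bool (t = w)) f s = f (- w + s)"
  unfolding convolve_def by (subst infsum_single_UNIV[of w]) auto

text \<open>Left translation is convolution on the left by a point mass, which belongs to
  \<open>L1\<close>.\<close>

lemma closed_left_ideal_translate:
  assumes "closed_left_ideal J" and "f \<in> J"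
  shows "(\<lambda>s. f (- w + s)) \<in> J"
proof -
  have "(\<lambda>x. cmod (of_bool (x = w))) summable_on UNIV \<longleftrightarrow>
    (\<lambda>x. cmod (of_bool (x = w))) summable_on {w}"
    by (rule summable_on_cong_neutral) auto
  then have "(\<lambda>t. of_bool (t = w)) \<in> L1" by (simp add: L1_def)
  then have "convolve (\<lambda>t. of_bool (t = w)) f \<in> J"
    using assms by (simp add: closed_left_ideal_def)
  then show ?thesis by (simp add: convolve_delta[abs_def])
qed

text \<open>Each diagonal of such an operator is either 0 or a left translate of \<open>a\<close>.
  The translation is moved onto \<open>f\<close>, and \<open>J\<close> is invariant under
  it.\<close>

lemma lam_mult_op_lam_annihilates:
  fixes J :: "('g :: {countable, group_add} \<Rightarrow> complex) set"
  assumes J: "closed_left_ideal J" and a: "a \<in> L1_perp J"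
  shows "lam x \<circ> mult_op a \<circ> lam y \<in> annihilator (Ran J)"
proof -
  have J1: "J \<subseteq> L1" using J by (simp add: closed_left_ideal_def)
  have ai: "a \<in> Linfty" using a by (simp add: L1_perp_def)
  let ?T = "lam x \<circ> mult_op a \<circ> lam y"
  \<comment> \<open>The support condition is \<open>- x + s + r = y + t + r\<close>. Here
    \<open>r\<close> cancels, so the condition holds on a whole diagonal or nowhere on it.\<close>
  have entry: "l2_fun (?T (ket (t + r))) (s + r) =
    (if - x + s = y + t then a (- x + s + r) else 0)" for s t r
    by (auto simp: lam.rep_eq l2_fun_mult_op[OF ai] lam_ket ket.rep_eq add.assoc[symmetric])
  have "(\<Sum>\<^sub>\<infinity>r. f r * l2_fun (?T (ket (t + r))) (s + r)) = 0" if f: "f \<in> J" for f s t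
  proof (cases "- x + s = y + t")
    case True
    define w where "w = - x + s"
    have "l2_fun (?T (ket (t + r))) (s + r) = a (w + r)" for r
      unfolding entry w_def using True by simp
    then have "(\<Sum>\<^sub>\<infinity>r. f r * l2_fun (?T (ket (t + r))) (s + r)) = (\<Sum>\<^sub>\<infinity>r. a (w + r) * f (- w + (w + r)))"
      by (simp only: minus_add_cancel mult.commute)
    also have "\<dots> = (\<Sum>\<^sub>\<infinity>r. a r * f (- w + r))"
      by (rule infsum_reindex_bij_betw[OF bij_add_left])
    also have "\<dots> = 0"
      using a closed_left_ideal_translate[OF J f, of w] by (simp add: L1_perp_def)
    finally show ?thesis .
  next
    case False
    then show ?thesis unfolding entry by simp
  qed
  then show ?thesis
    by (simp add: annihilator_Ran_iff_entries[OF J1] BL2_compose BL2_lam BL2_mult_op ai)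
qed

lemma BL2_summable_norm_square:
  assumes "C \<in> BL2" "summable (\<lambda>i. (norm (F i))\<^sup>2)"
  shows "summable (\<lambda>i. (norm (C (F i)))\<^sup>2)"
proof (rule summable_comparison_test'[OF summable_mult[OF assms(2), of "(onorm C)\<^sup>2"]])
  show "norm ((norm (C (F i)))\<^sup>2) \<le> (onorm C)\<^sup>2 * (norm (F i))\<^sup>2" for i
    using power_mono[OF BL2_norm_le[OF assms(1), of "F i"], of 2] by (simp add: power_mult_distrib)
qed

text \<open>The preadjoint of right multiplication by \<open>C\<close> applies \<open>C\<close> to
  the first leg of the kernel.\<close>

lemma tpair_compose_right:
  assumes C: "C \<in> BL2" and h: "h \<in> trace_class"
  shows "\<exists>k\<in>trace_class. \<forall>A\<in>BL2. tpair (A \<circ> C) h = tpair A k"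
proof -
  obtain F G where r: "represents F G h" using h by (auto simp: trace_class_def)
  define k where "k = (\<lambda>(x, y). \<Sum>i. l2_fun (C (F i)) x * l2_fun (G i) y)"
  have rk: "represents (\<lambda>i. C (F i)) G k"
    using r BL2_summable_norm_square[OF C] by (simp add: represents_def k_def)
  have "tpair (A \<circ> C) h = tpair A k" if A: "A \<in> BL2" for A
    by (simp add: tpair_eq[OF BL2_compose[OF A C] r] tpair_eq[OF A rk])
  with rk show ?thesis unfolding trace_class_def by blast
qed

text \<open>The preadjoint of left multiplication by \<open>C\<close> acts on the second leg through
  the adjoint \<open>D\<close>. The conjugations around \<open>D\<close> match the one that
  \<open>tpair\<close> applies to that leg.\<close>

lemma tpair_compose_left:
  assumes C: "C \<in> BL2" and D: "D \<in> BL2" and adj: "\<And>\<xi> \<eta>. cinner (C \<xi>) \<eta> = cinner \<xi> (D \<eta>)"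
    and h: "h \<in> trace_class"
  shows "\<exists>k\<in>trace_class. \<forall>B\<in>BL2. tpair (C \<circ> B) h = tpair B k"
proof -
  obtain F G where r: "represents F G h" using h by (auto simp: trace_class_def)
  define G' where "G' i = l2_cnj (D (l2_cnj (G i)))" for i
  define k where "k = (\<lambda>(x, y). \<Sum>i. l2_fun (F i) x * l2_fun (G' i) y)"
  have rk: "represents F G' k"
    using r BL2_summable_norm_square[OF D, of "\<lambda>i. l2_cnj (G i)"]
    by (simp add: represents_def k_def G'_def norm_l2_cnj)
  have "tpair (C \<circ> B) h = tpair B k" if B: "B \<in> BL2" for B
    by (simp add: tpair_eq[OF BL2_compose[OF C B] r] tpair_eq[OF B rk] G'_def adj)
  with rk show ?thesis unfolding trace_class_def by blast
qed

lemma VN_subset_BL2: "VN \<subseteq> BL2"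
  unfolding VN_def using closure_of_subset_topspace[of weak_star] by (simp add: topspace_weak_star)

text \<open>The assumption \<open>dual\<close> is weak* continuity of \<open>\<Phi>\<close> as seen
  by \<open>R\<close>. It makes the preimage of an annihilator an annihilator again, hence a weak*
  closed subspace, which contains \<open>VN\<close> once it contains every
  \<open>lam x\<close>.\<close>

lemma VN_preimage_annihilator:
  assumes R: "R \<subseteq> trace_class"
    and dual: "\<And>h. h \<in> R \<Longrightarrow> \<exists>k\<in>trace_class. \<forall>A\<in>BL2. tpair (\<Phi> A) h = tpair A k"
    and \<Phi>: "\<And>A. A \<in> BL2 \<Longrightarrow> \<Phi> A \<in> BL2"
    and lam: "\<And>x. \<Phi> (lam x) \<in> annihilator R" and A: "A \<in> VN"
  shows "\<Phi> A \<in> annihilator R"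
proof -
  obtain \<phi> where \<phi>: "\<And>h. h \<in> R \<Longrightarrow> \<phi> h \<in> trace_class"
    "\<And>h A. h \<in> R \<Longrightarrow> A \<in> BL2 \<Longrightarrow> tpair (\<Phi> A) h = tpair A (\<phi> h)"
    using dual by metis
  have iff: "\<Phi> A \<in> annihilator R \<longleftrightarrow> A \<in> annihilator (\<phi> ` R)" if "A \<in> BL2" for A
    using that \<phi> \<Phi> by (auto simp: annihilator_def)
  have "VN \<subseteq> annihilator (\<phi> ` R)"
    unfolding VN_def
    by (rule closure_op_span_subset_annihilator) (use \<phi>(1) iff[OF BL2_lam] lam in auto)
  then show ?thesis using iff A VN_subset_BL2 by blast
qed

text \<open>The right factor is extended from \<open>\<lambda>\<^sub>y\<close> to \<open>VN(G)\<close> first: this uses the adjoint of the left factor, which is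
  explicit only as long as that factor is \<open>\<lambda>\<^sub>x M\<^sub>a\<close>.\<close>

lemma Bim_subset_annihilator:
  fixes J :: "('g :: {countable, group_add} \<Rightarrow> complex) set"
  assumes J: "closed_left_ideal J"
  shows "Bim (L1_perp J) \<subseteq> annihilator (Ran J)"
  unfolding Bim_def
proof (rule closure_op_span_subset_annihilator[OF Ran_subset_trace_class], safe)
  fix A B :: "'g l2 \<Rightarrow> 'g l2" and a assume A: "A \<in> VN" and B: "B \<in> VN" and a: "a \<in> L1_perp J"
  have ai: "a \<in> Linfty" using a by (simp add: L1_perp_def)
  have R: "h \<in> Ran J \<Longrightarrow> h \<in> trace_class" for h using Ran_subset_trace_class by blast
  have B2: "B \<in> BL2" using B VN_subset_BL2 by blast
  have 1: "(lam x \<circ> mult_op a) \<circ> B \<in> annihilator (Ran J)" for x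
  proof (rule VN_preimage_annihilator[where \<Phi> = "\<lambda>B. (lam x \<circ> mult_op a) \<circ> B", OF Ran_subset_trace_class _ _ _ B])
    show "\<exists>k\<in>trace_class. \<forall>B\<in>BL2. tpair ((lam x \<circ> mult_op a) \<circ> B) h = tpair B k"
      if "h \<in> Ran J" for h
      by (rule tpair_compose_left[where D = "mult_op (\<lambda>x. cnj (a x)) \<circ> lam (- x)"])
        (simp_all add: BL2_compose BL2_lam BL2_mult_op ai cnj_Linfty cinner_lam cinner_mult_op R that)
  qed (simp_all add: BL2_compose BL2_lam BL2_mult_op ai lam_mult_op_lam_annihilates[OF J a])
  have "A \<circ> (mult_op a \<circ> B) \<in> annihilator (Ran J)"
  proof (rule VN_preimage_annihilator[where \<Phi> = "\<lambda>A. A \<circ> (mult_op a \<circ> B)", OF Ran_subset_trace_class _ _ _ A])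
    show "\<exists>k\<in>trace_class. \<forall>A\<in>BL2. tpair (A \<circ> (mult_op a \<circ> B)) h = tpair A k"
      if "h \<in> Ran J" for h
      by (rule tpair_compose_right) (simp_all add: BL2_compose B2 BL2_mult_op ai R that)
    show "lam x \<circ> (mult_op a \<circ> B) \<in> annihilator (Ran J)" for x
      using 1[of x] by (simp add: comp_assoc)
  qed (simp add: BL2_compose B2 BL2_mult_op ai)
  then show "A \<circ> mult_op a \<circ> B \<in> annihilator (Ran J)" by (simp add: comp_assoc)
qed

section \<open>Multipliers of the Fourier algebra as Schur multipliers\<close>

lemma lam_in_VN:
  fixes x :: "'g :: group_add"
  shows "(\<lambda>\<xi>. c *\<^sub>C lam x \<xi>) \<in> VN"
proof -
  have "range (lam :: 'g \<Rightarrow> _) \<subseteq> BL2" using BL2_lam by blast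
  then have "op_span (range (lam :: 'g \<Rightarrow> _)) \<subseteq> VN"
    unfolding VN_def by (intro closure_of_subset) (simp only: topspace_weak_star op_span_subset_BL2)
  moreover have "(\<lambda>\<xi>. c *\<^sub>C lam x \<xi>) \<in> op_span (range lam)"
    by (intro module.span_scale[OF module_operators] module.span_base[OF module_operators]) simp
  ultimately show ?thesis by blast
qed

text \<open>Two ways of writing \<open>v\<close> as a coefficient differ by a trace class kernel
  \<open>h\<close> that annihilates every \<open>lam x\<close>. Being an annihilation condition,
  this extends to \<open>VN\<close>, so the value at \<open>T\<close> is independent of the
  choice.\<close>

lemma vn_pair_eq:
  assumes T: "T \<in> VN" and v: "\<And>x. v x = cinner (lam x \<xi>) \<eta>"
  shows "vn_pair T v = cinner (T \<xi>) \<eta>"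
  unfolding vn_pair_def
proof (rule the_equality)
  fix c assume "\<exists>\<xi> \<eta>. (\<forall>x. v x = cinner (lam x \<xi>) \<eta>) \<and> c = cinner (T \<xi>) \<eta>"
  then obtain \<xi>' \<eta>' where v': "\<And>x. v x = cinner (lam x \<xi>') \<eta>'" and c: "c = cinner (T \<xi>') \<eta>'"
    by blast
  define h where "h = (\<lambda>p. rank_one \<xi>' (l2_cnj \<eta>') p - rank_one \<xi> (l2_cnj \<eta>) p)"
  have h: "h \<in> trace_class" unfolding h_def by (intro trace_class_diff rank_one_trace_class)
  have pair: "tpair A h = cinner (A \<xi>') \<eta>' - cinner (A \<xi>) \<eta>" if "A \<in> BL2" for A
    by (simp add: h_def tpair_diff that rank_one_trace_class tpair_rank_one)
  have "range lam \<subseteq> annihilator {h}"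
    using v v' by (auto simp: annihilator_def BL2_lam pair)
  then have "VN \<subseteq> annihilator {h}"
    unfolding VN_def using h by (intro closure_op_span_subset_annihilator) auto
  then have "tpair T h = 0" using T by (auto simp: annihilator_def)
  then show "c = cinner (T \<xi>) \<eta>" using pair T VN_subset_BL2 c by fastforce
qed (use v in blast)

lemma finite_support_fourier:
  assumes "finite {s. w s \<noteq> (0 :: complex)}"
  obtains \<xi> where "\<And>x. w x = cinner (lam x \<xi>) (ket 0)"
proof
  \<comment> \<open>\<open>lam x\<close> moves \<open>ket (- s)\<close> to
    \<open>ket (x - s)\<close>, whose value at 0 is 1 exactly when \<open>s = x\<close>.\<close>
  let ?\<xi> = "\<Sum>s\<in>{s. w s \<noteq> 0}. w s *\<^sub>C ket (- s)"
  show "w x = cinner (lam x ?\<xi>) (ket 0)" for x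
  proof -
    have "cinner (lam x ?\<xi>) (ket 0) = (\<Sum>s\<in>{s. w s \<noteq> 0}. if x = s then w s else 0)"
      unfolding cinner_ket_right lam.rep_eq l2_fun_sum
      by (rule sum.cong) (auto simp: l2_fun_simps ket.rep_eq)
    then show ?thesis using assms by simp
  qed
qed

text \<open>Multiplying by \<open>u\<close> leaves a finitely supported function, for which explicit
  vectors are known, so both pairings can be evaluated. Uniqueness follows by testing on
  coefficients with second vector \<open>ket y\<close>, which read off the coordinates of
  \<open>S \<xi>\<close>.\<close>

lemma mult_dual_lam:
  fixes u :: "'g :: group_add \<Rightarrow> complex"
  assumes u: "finite {s. u s \<noteq> 0}"
  shows "mult_dual u (\<lambda>\<xi>. c *\<^sub>C lam x \<xi>) = (\<lambda>\<xi>. (c * u x) *\<^sub>C lam x \<xi>)"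
  unfolding mult_dual_def
proof (rule the_equality)
  let ?S = "\<lambda>\<xi>. (c * u x) *\<^sub>C lam x \<xi>" and ?T = "\<lambda>\<xi>. c *\<^sub>C lam x \<xi>"
  have *: "vn_pair ?S v = vn_pair ?T (\<lambda>x. u x * v x)"
    if v: "\<And>x. v x = cinner (lam x \<xi>) \<eta>" for v \<xi> \<eta>
  proof -
    have "finite {s. u s * v s \<noteq> 0}" by (rule finite_subset[OF _ u]) auto
    then obtain \<zeta> where \<zeta>: "\<And>x. u x * v x = cinner (lam x \<zeta>) (ket 0)"
      by (rule finite_support_fourier) blast
    have "vn_pair ?S v = c * (u x * v x)"
      by (simp add: vn_pair_eq[where \<xi> = \<xi> and \<eta> = \<eta>, OF lam_in_VN v] cinner_scaleC_left v)
    moreover have "vn_pair ?T (\<lambda>x. u x * v x) = cinner (?T \<zeta>) (ket 0)"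
      by (rule vn_pair_eq[OF lam_in_VN \<zeta>])
    ultimately show ?thesis by (simp only: cinner_scaleC_left \<zeta>)
  qed
  then show "?S \<in> VN \<and> (\<forall>v\<in>fourier_algebra. vn_pair ?S v = vn_pair ?T (\<lambda>x. u x * v x))"
    by (auto simp: fourier_algebra_def lam_in_VN)
  fix S assume S: "S \<in> VN \<and> (\<forall>v\<in>fourier_algebra. vn_pair S v = vn_pair ?T (\<lambda>x. u x * v x))"
  show "S = ?S"
  proof (intro ext l2_eqI)
    fix \<xi> :: "'g l2" and y
    let ?v = "\<lambda>x. cinner (lam x \<xi>) (ket y)"
    have "?v \<in> fourier_algebra" by (auto simp: fourier_algebra_def)
    then have "vn_pair S ?v = vn_pair ?S ?v" using S *[of ?v \<xi> "ket y"] by simp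
    then have "cinner (S \<xi>) (ket y) = cinner (?S \<xi>) (ket y)"
      using vn_pair_eq[of S ?v \<xi> "ket y"] vn_pair_eq[OF lam_in_VN, of ?v \<xi> "ket y"] S by simp
    then show "l2_fun (S \<xi>) y = l2_fun (?S \<xi>) y" by (simp add: cinner_ket_right)
  qed
qed

section \<open>Operator matrices and finite blocks of an operator\<close>

lemma matrix_norm_upper:
  fixes X :: "nat \<Rightarrow> nat \<Rightarrow> 'a l2 \<Rightarrow> 'a l2"
  assumes X: "\<And>i j. X i j \<in> BL2" and \<xi>: "(\<Sum>j<n. (norm (\<xi> j))\<^sup>2) \<le> 1"
  shows "sqrt (\<Sum>i<n. (norm (\<Sum>j<n. X i j (\<xi> j)))\<^sup>2) \<le> matrix_norm n X"
  unfolding matrix_norm_def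
proof (rule cSUP_upper)
  show "\<xi> \<in> {\<xi>. (\<Sum>j<n. (norm (\<xi> j))\<^sup>2) \<le> 1}" using \<xi> by simp
  \<comment> \<open>A real supremum bounds its members only if the set is bounded; the sums of the
    operator norms along the rows provide a crude bound.\<close>
  show "bdd_above ((\<lambda>\<xi>. sqrt (\<Sum>i<n. (norm (\<Sum>j<n. X i j (\<xi> j)))\<^sup>2)) ` {\<xi>. (\<Sum>j<n. (norm (\<xi> j))\<^sup>2) \<le> 1})"
  proof (rule bdd_aboveI2)
    fix \<xi> :: "nat \<Rightarrow> 'a l2" assume "\<xi> \<in> {\<xi>. (\<Sum>j<n. (norm (\<xi> j))\<^sup>2) \<le> 1}"
    then have \<xi>: "(\<Sum>j<n. (norm (\<xi> j))\<^sup>2) \<le> 1" by simp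
    have 1: "norm (\<xi> j) \<le> 1" if "j < n" for j
    proof -
      have "(norm (\<xi> j))\<^sup>2 \<le> (\<Sum>j<n. (norm (\<xi> j))\<^sup>2)" using that by (intro member_le_sum) auto
      with \<xi> have "(norm (\<xi> j))\<^sup>2 \<le> 1\<^sup>2" by simp
      then show ?thesis by (rule power2_le_imp_le) simp
    qed
    have "norm (\<Sum>j<n. X i j (\<xi> j)) \<le> (\<Sum>j<n. onorm (X i j))" for i
    proof (rule sum_norm_le)
      fix j assume "j \<in> {..<n}"
      then have "onorm (X i j) * norm (\<xi> j) \<le> onorm (X i j) * 1"
        using 1 by (intro mult_left_mono onorm_pos_le BL2_bounded_linear X) auto
      then show "norm (X i j (\<xi> j)) \<le> onorm (X i j)" using BL2_norm_le[OF X, of i j "\<xi> j"] by simp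
    qed
    then show "sqrt (\<Sum>i<n. (norm (\<Sum>j<n. X i j (\<xi> j)))\<^sup>2) \<le> sqrt (\<Sum>i<n. (\<Sum>j<n. onorm (X i j))\<^sup>2)"
      by (intro real_sqrt_le_mono sum_mono power_mono) auto
  qed
qed

lemma entries_bound:
  assumes T: "T \<in> BL2" and F: "finite F"
  shows "(\<Sum>s\<in>F. (cmod (\<Sum>t\<in>F. \<beta> t * l2_fun (T (ket t)) s))\<^sup>2) \<le> (onorm T)\<^sup>2 * (\<Sum>t\<in>F. (cmod (\<beta> t))\<^sup>2)"
proof -
  define \<xi> where "\<xi> = (\<Sum>t\<in>F. \<beta> t *\<^sub>C ket t)"
  have \<xi>: "l2_fun \<xi> x = (if x \<in> F then \<beta> x else 0)" for x
  proof -
    have "l2_fun \<xi> x = (\<Sum>t\<in>F. if x = t then \<beta> t else 0)"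
      unfolding \<xi>_def l2_fun_sum by (rule sum.cong) (auto simp: l2_fun_simps ket.rep_eq)
    then show ?thesis using F by simp
  qed
  have "trunc F \<xi> = \<xi>" by (rule l2_eqI) (simp add: l2_fun_trunc F \<xi>)
  then have norm_\<xi>: "(norm \<xi>)\<^sup>2 = (\<Sum>t\<in>F. (cmod (\<beta> t))\<^sup>2)"
    using norm_diff_trunc[OF F, of \<xi>] by (simp add: \<xi>)
  have "l2_fun (T \<xi>) s = (\<Sum>t\<in>F. \<beta> t * l2_fun (T (ket t)) s)" for s
    by (simp add: \<xi>_def BL2_sum[OF T] BL2_scaleC[OF T] l2_fun_sum l2_fun_simps)
  then have "(\<Sum>s\<in>F. (cmod (\<Sum>t\<in>F. \<beta> t * l2_fun (T (ket t)) s))\<^sup>2) \<le> (norm (T \<xi>))\<^sup>2"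
    using sum_le_norm_l2[OF F, of "T \<xi>"] by simp
  also have "\<dots> \<le> (onorm T * norm \<xi>)\<^sup>2" by (intro power_mono BL2_norm_le T) simp
  finally show ?thesis by (simp add: power_mult_distrib norm_\<xi>)
qed

lemma has_sum_finite_sum:
  fixes f :: "'i \<Rightarrow> 'a \<Rightarrow> 'b :: real_normed_vector"
  assumes "\<And>i. i \<in> F \<Longrightarrow> (f i has_sum c i) A"
  shows "((\<lambda>x. \<Sum>i\<in>F. f i x) has_sum (\<Sum>i\<in>F. c i)) A"
  using assms by (induction F rule: infinite_finite_induct) (auto intro: has_sum_add)

lemma has_sum_sum_power2_norm:
  "((\<lambda>x. \<Sum>i\<in>F. (cmod (l2_fun (\<xi> i) x))\<^sup>2) has_sum (\<Sum>i\<in>F. (norm (\<xi> i))\<^sup>2)) UNIV"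
  unfolding power2_norm_l2 by (intro has_sum_finite_sum has_sum_infsum l2_summable)

text \<open>The matrix \<open>m\<close> acts separately on each coordinate \<open>x\<close>; the
  scalar inequality is applied there and summed over \<open>x\<close>. This is contractivity of
  \<open>m\<close> tensored with the identity.\<close>

lemma scalar_matrix_contraction:
  fixes m :: "nat \<Rightarrow> nat \<Rightarrow> complex" and \<zeta> :: "nat \<Rightarrow> 'a l2"
  assumes m: "\<And>\<beta>. (\<Sum>i<n. (cmod (\<Sum>j<n. m i j * \<beta> j))\<^sup>2) \<le> (\<Sum>j<n. (cmod (\<beta> j))\<^sup>2)"
  shows "(\<Sum>i<n. (norm (\<Sum>j<n. m i j *\<^sub>C \<zeta> j))\<^sup>2) \<le> (\<Sum>j<n. (norm (\<zeta> j))\<^sup>2)"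
proof (rule has_sum_mono[OF has_sum_sum_power2_norm has_sum_sum_power2_norm])
  show "(\<Sum>i<n. (cmod (l2_fun (\<Sum>j<n. m i j *\<^sub>C \<zeta> j) x))\<^sup>2) \<le> (\<Sum>j<n. (cmod (l2_fun (\<zeta> j) x))\<^sup>2)"
    for x
    using m[of "\<lambda>j. l2_fun (\<zeta> j) x"] by (simp add: l2_fun_sum l2_fun_simps)
qed

text \<open>This transfers the completely bounded bound on \<open>VN\<close> to the block of the
  Schur product over \<open>F\<close>. The block of \<open>T\<close> is spread over
  \<open>VN\<close> as the matrix \<open>X\<close>, the multiplier turns \<open>X\<close> into
  \<open>Y\<close>, and suitable test vectors read the Schur product off \<open>Y\<close>.\<close>

lemma schur_entries_bound:
  fixes u :: "'g :: group_add \<Rightarrow> complex"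
  assumes u: "finite {s. u s \<noteq> 0}" and mcb: "mcb_norm u \<le> ennreal L" and L: "L > 0"
    and T: "T \<in> BL2" and F: "finite F" and \<alpha>: "(\<Sum>t\<in>F. (cmod (\<alpha> t))\<^sup>2) \<le> 1"
  shows "(\<Sum>s\<in>F. (cmod (\<Sum>t\<in>F. \<alpha> t * (u (s - t) * l2_fun (T (ket t)) s)))\<^sup>2) \<le> (L * (onorm T + 1))\<^sup>2"
proof -
  \<comment> \<open>Division by \<open>c\<close>, which is positive, makes the block of
    \<open>T\<close> a contraction and so admissible in \<open>cb_norm\<close>.\<close>
  define c where "c = onorm T + 1"
  have c: "c > 0" "onorm T \<le> c" "0 \<le> onorm T"
    using onorm_pos_le[OF BL2_bounded_linear[OF T]] by (simp_all add: c_def)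
  define n where "n = card F"
  obtain e where e: "bij_betw e {..<n} F"
    using ex_bij_betw_nat_finite[OF F] by (auto simp: n_def atLeast0LessThan)
  \<comment> \<open>The inverse of the enumeration turns coefficients indexed by numbers into
    coefficients indexed by \<open>F\<close>, as \<open>entries_bound\<close> expects.\<close>
  define d where "d = inv_into {..<n} e"
  have d: "d (e i) = i" if "i < n" for i
    using e that by (simp add: d_def bij_betw_def inv_into_f_f)
  have reindex: "(\<Sum>s\<in>F. \<phi> s) = (\<Sum>i<n. \<phi> (e i))" for \<phi> :: "'g \<Rightarrow> 'b :: comm_monoid_add"
    by (rule sum.reindex_bij_betw[OF e, symmetric])
  define m where "m i j = l2_fun (T (ket (e j))) (e i) / complex_of_real c" for i j
  have m: "(\<Sum>i<n. (cmod (\<Sum>j<n. m i j * \<beta> j))\<^sup>2) \<le> (\<Sum>j<n. (cmod (\<beta> j))\<^sup>2)" for \<beta>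
  proof -
    have "(\<Sum>j<n. m i j * \<beta> j) = (\<Sum>j<n. \<beta> j * l2_fun (T (ket (e j))) (e i)) / complex_of_real c" for i
      by (simp add: m_def sum_divide_distrib mult.commute)
    then have "(\<Sum>i<n. (cmod (\<Sum>j<n. m i j * \<beta> j))\<^sup>2) = (\<Sum>i<n. (cmod (\<Sum>j<n. \<beta> j * l2_fun (T (ket (e j))) (e i)))\<^sup>2) / c\<^sup>2"
      using c by (simp only: norm_divide power_divide sum_divide_distrib[symmetric] norm_of_real abs_of_pos)
    moreover have "(\<Sum>i<n. (cmod (\<Sum>j<n. \<beta> j * l2_fun (T (ket (e j))) (e i)))\<^sup>2)
      \<le> (onorm T)\<^sup>2 * (\<Sum>j<n. (cmod (\<beta> j))\<^sup>2)"
      using entries_bound[OF T F, of "\<lambda>t. \<beta> (d t)"] by (simp add: reindex d)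
    moreover have "\<dots> \<le> c\<^sup>2 * (\<Sum>j<n. (cmod (\<beta> j))\<^sup>2)"
      using c by (intro mult_right_mono power_mono sum_nonneg) auto
    ultimately show ?thesis using c by (simp add: divide_le_eq mult.commute)
  qed
  define X where "X i j = (\<lambda>\<xi>. m i j *\<^sub>C lam (e i - e j) \<xi>)" for i j
  have X_VN: "X i j \<in> VN" for i j unfolding X_def by (rule lam_in_VN)
  have "matrix_norm n X \<le> 1"
    unfolding matrix_norm_def
  proof (rule cSUP_least)
    show "{\<xi> :: nat \<Rightarrow> 'g l2. (\<Sum>j<n. (norm (\<xi> j))\<^sup>2) \<le> 1} \<noteq> {}"
      by (auto intro!: exI[of _ "\<lambda>_. 0"])
    fix \<xi> :: "nat \<Rightarrow> 'g l2" assume "\<xi> \<in> {\<xi>. (\<Sum>j<n. (norm (\<xi> j))\<^sup>2) \<le> 1}"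
    then have \<xi>: "(\<Sum>j<n. (norm (\<xi> j))\<^sup>2) \<le> 1" by simp
    \<comment> \<open>The adjoint of the diagonal unitary with entries \<open>lam (e j)\<close> is
      applied to the input. Pulling the other unitary \<open>lam (e i)\<close> out of row
      \<open>i\<close> leaves the scalar matrix \<open>m\<close>.\<close>
    define \<zeta> where "\<zeta> j = lam (- e j) (\<xi> j)" for j
    have "(\<Sum>j<n. X i j (\<xi> j)) = lam (e i) (\<Sum>j<n. m i j *\<^sub>C \<zeta> j)" for i
      by (simp add: X_def \<zeta>_def BL2_sum[OF BL2_lam] BL2_scaleC[OF BL2_lam] lam_lam)
    then have "(\<Sum>i<n. (norm (\<Sum>j<n. X i j (\<xi> j)))\<^sup>2) = (\<Sum>i<n. (norm (\<Sum>j<n. m i j *\<^sub>C \<zeta> j))\<^sup>2)"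
      by simp
    also have "\<dots> \<le> (\<Sum>j<n. (norm (\<zeta> j))\<^sup>2)" by (rule scalar_matrix_contraction[OF m])
    also have "\<dots> \<le> 1" using \<xi> by (simp add: \<zeta>_def)
    finally show "sqrt (\<Sum>i<n. (norm (\<Sum>j<n. X i j (\<xi> j)))\<^sup>2) \<le> 1" by simp
  qed
  then have X: "X \<in> {X. (\<forall>i<n. \<forall>j<n. X i j \<in> VN) \<and> matrix_norm n X \<le> 1}"
    using X_VN by simp
  define Y where "Y i j = mult_dual u (X i j)" for i j
  have Y: "Y i j = (\<lambda>\<xi>. (m i j * u (e i - e j)) *\<^sub>C lam (e i - e j) \<xi>)" for i j
    unfolding Y_def X_def by (rule mult_dual_lam[OF u])
  have "ennreal (matrix_norm n Y) \<le> cb_norm (mult_dual u)"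
    unfolding cb_norm_def Y_def by (rule SUP_upper2[OF UNIV_I], rule SUP_upper2[OF X order_refl])
  also have "\<dots> \<le> ennreal L" using mcb by (simp add: mcb_norm_def)
  finally have YL: "matrix_norm n Y \<le> L" using L by (simp add: ennreal_le_iff)
  \<comment> \<open>Since \<open>lam (e i - e j)\<close> sends \<open>ket (e j)\<close> to
    \<open>ket (e i)\<close>, with this input row \<open>i\<close> collapses to a scalar multiple of
    \<open>ket (e i)\<close>, and \<open>b i / c\<close> is that scalar.\<close>
  define \<xi> where "\<xi> j = \<alpha> (e j) *\<^sub>C ket (e j)" for j
  have "(\<Sum>j<n. (norm (\<xi> j))\<^sup>2) \<le> 1" using \<alpha> by (simp add: \<xi>_def norm_scaleC reindex)
  moreover have "Y i j \<in> BL2" for i j unfolding Y by (intro BL2_op_scaleC BL2_lam)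
  ultimately have "sqrt (\<Sum>i<n. (norm (\<Sum>j<n. Y i j (\<xi> j)))\<^sup>2) \<le> matrix_norm n Y"
    by (intro matrix_norm_upper)
  with YL have le: "sqrt (\<Sum>i<n. (norm (\<Sum>j<n. Y i j (\<xi> j)))\<^sup>2) \<le> L" by linarith
  define b where "b i = (\<Sum>j<n. \<alpha> (e j) * (u (e i - e j) * l2_fun (T (ket (e j))) (e i)))" for i
  have "(\<Sum>j<n. Y i j (\<xi> j)) = (b i / complex_of_real c) *\<^sub>C ket (e i)" for i
    by (rule l2_eqI)
      (simp add: Y \<xi>_def BL2_scaleC[OF BL2_lam] lam_ket l2_fun_sum l2_fun_simps b_def m_def
        sum_divide_distrib sum_distrib_left mult_ac)
  then have "(\<Sum>i<n. (norm (\<Sum>j<n. Y i j (\<xi> j)))\<^sup>2) = (\<Sum>i<n. (cmod (b i))\<^sup>2) / c\<^sup>2"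
    by (simp add: norm_scaleC norm_divide power_divide sum_divide_distrib)
  with le have "sqrt ((\<Sum>i<n. (cmod (b i))\<^sup>2) / c\<^sup>2) \<le> L" by simp
  then have "(\<Sum>i<n. (cmod (b i))\<^sup>2) / c\<^sup>2 \<le> L\<^sup>2" by (rule sqrt_le_D)
  then have "(\<Sum>i<n. (cmod (b i))\<^sup>2) \<le> (L * c)\<^sup>2"
    using c by (simp add: field_simps power_mult_distrib)
  then show ?thesis by (simp add: reindex b_def c_def)
qed

text \<open>The positions \<open>(r, z + r)\<close> form one orbit under simultaneous right
  translation of row and column, the motion of entries effected by \<open>conj_rho\<close>.\<close>

definition diagonal :: "('g :: group_add l2 \<Rightarrow> 'g l2) \<Rightarrow> 'g \<Rightarrow> 'g \<Rightarrow> complex" where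
  "diagonal T z r = l2_fun (T (ket (z + r))) r"

text \<open>The trivial factor \<open>lam 0\<close> gives each summand the shape \<open>A M\<^sub>a B\<close> of the generators of \<open>Bim\<close>.\<close>

definition schur :: "('g :: group_add \<Rightarrow> complex) \<Rightarrow> ('g l2 \<Rightarrow> 'g l2) \<Rightarrow> 'g l2 \<Rightarrow> 'g l2" where
  "schur u T = (\<Sum>z\<in>{z. u (- z) \<noteq> 0}. (\<lambda>\<xi>. u (- z) *\<^sub>C (lam 0 \<circ> mult_op (diagonal T z) \<circ> lam (- z)) \<xi>))"

lemma diagonal_Linfty:
  assumes "T \<in> BL2"
  shows "diagonal T z \<in> Linfty"
proof -
  have "cmod (diagonal T z r) \<le> onorm T" for r
    using l2_fun_le_norm[of "T (ket (z + r))" r] BL2_norm_le[OF assms, of "ket (z + r)"]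
    by (simp add: diagonal_def)
  then show ?thesis by (auto simp: Linfty_def bounded_iff)
qed

lemma BL2_schur: "T \<in> BL2 \<Longrightarrow> schur u T \<in> BL2"
  unfolding schur_def
  by (intro BL2_op_sum BL2_op_scaleC BL2_compose BL2_lam BL2_mult_op diagonal_Linfty)

lemma op_sum_apply: "(\<Sum>i\<in>F. f i) \<xi> = (\<Sum>i\<in>F. f i \<xi>)" for f :: "'i \<Rightarrow> 'a l2 \<Rightarrow> 'a l2"
  by (induction F rule: infinite_finite_induct) auto

text \<open>The summand for \<open>z\<close> has entries only at positions with
  \<open>t = z + s\<close>, so a given entry is seen by the single index
  \<open>z = t - s\<close>.\<close>

lemma schur_entry:
  fixes u :: "'g :: group_add \<Rightarrow> complex"
  assumes u: "finite {s. u s \<noteq> 0}" and T: "T \<in> BL2"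
  shows "l2_fun (schur u T (ket t)) s = u (s - t) * l2_fun (T (ket t)) s"
proof -
  let ?Z = "{z. u (- z) \<noteq> 0}"
  have "?Z = uminus ` {s. u s \<noteq> 0}" by (force simp: image_iff)
  \<comment> \<open>Finiteness matters: a sum over an infinite index set would be 0 by
    convention.\<close>
  then have Z: "finite ?Z" using u by simp
  have eq: "s = - z + t \<longleftrightarrow> z = t - s" for z
    unfolding eq_diff_eq by (metis minus_add_cancel add_minus_cancel)
  have "l2_fun (schur u T (ket t)) s = (\<Sum>z\<in>?Z. if z = t - s then u (- z) * diagonal T z s else 0)"
    unfolding schur_def op_sum_apply l2_fun_sum
    by (rule sum.cong)
      (auto simp: l2_fun_simps lam.rep_eq l2_fun_mult_op[OF diagonal_Linfty[OF T]] lam_ket ket.rep_eq eq)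
  also have "\<dots> = (if t - s \<in> ?Z then u (- (t - s)) * diagonal T (t - s) s else 0)"
    using Z by simp
  also have "\<dots> = u (s - t) * l2_fun (T (ket t)) s"
    by (simp add: diagonal_def)
  finally show ?thesis .
qed

text \<open>The block estimate bounds the action on truncated unit vectors uniformly in
  \<open>F\<close>; letting \<open>F\<close> grow, and then rescaling, gives all vectors. The bound
  depends on \<open>u\<close> only through \<open>L\<close>.\<close>

lemma norm_schur_le:
  fixes u :: "'g :: group_add \<Rightarrow> complex"
  assumes u: "finite {s. u s \<noteq> 0}" and mcb: "mcb_norm u \<le> ennreal L" and L: "L > 0"
    and T: "T \<in> BL2"
  shows "norm (schur u T \<xi>) \<le> L * (onorm T + 1) * norm \<xi>"
proof -
  define K where "K = L * (onorm T + 1)"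
  have K: "K \<ge> 0" using L onorm_pos_le[OF BL2_bounded_linear[OF T]] by (simp add: K_def)
  note S = BL2_schur[OF T, of u]
  have trunc_bound: "(\<Sum>s\<in>F. (cmod (l2_fun (schur u T (trunc F \<xi>)) s))\<^sup>2) \<le> K\<^sup>2"
    if F: "finite F" and \<xi>: "norm \<xi> \<le> 1" for F \<xi>
  proof -
    have "(\<Sum>t\<in>F. (cmod (l2_fun \<xi> t))\<^sup>2) \<le> 1"
      using sum_le_norm_l2[OF F, of \<xi>] \<xi> power_le_one[of "norm \<xi>" 2] by simp
    from schur_entries_bound[OF u mcb L T F this] show ?thesis
      by (simp add: K_def BL2_trunc[OF S] l2_fun_sum l2_fun_simps schur_entry[OF u T])
  qed
  have unit_bound: "norm (schur u T \<xi>) \<le> K" if \<xi>: "norm \<xi> \<le> 1" for \<xi>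
  proof (rule norm_l2_leI[OF _ K])
    fix E :: "'g set" assume E: "finite E"
    have "((\<lambda>F. l2_fun (schur u T (trunc F \<xi>)) x) \<longlongrightarrow> l2_fun (schur u T \<xi>) x)
      (finite_subsets_at_top UNIV)" for x
      using bounded_linear.tendsto[OF bounded_linear_cinner_left[of "ket x"]
          BL2_tendsto[OF S trunc_tendsto[of \<xi>]]]
      by (simp add: cinner_ket_right)
    then have lim: "((\<lambda>F. \<Sum>x\<in>E. (cmod (l2_fun (schur u T (trunc F \<xi>)) x))\<^sup>2) \<longlongrightarrow>
      (\<Sum>x\<in>E. (cmod (l2_fun (schur u T \<xi>) x))\<^sup>2)) (finite_subsets_at_top UNIV)"
      by (intro tendsto_intros)
    \<comment> \<open>The block estimate uses one set \<open>F\<close> for rows and columns. For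
      \<open>F\<close> containing \<open>E\<close>, the sum over \<open>E\<close> is at most the sum
      over \<open>F\<close>.\<close>
    have "\<forall>\<^sub>F F in finite_subsets_at_top UNIV.
      (\<Sum>x\<in>E. (cmod (l2_fun (schur u T (trunc F \<xi>)) x))\<^sup>2) \<le> K\<^sup>2"
      unfolding eventually_finite_subsets_at_top
    proof (intro exI[of _ E] conjI allI impI)
      fix F assume F: "finite F \<and> E \<subseteq> F \<and> F \<subseteq> UNIV"
      have "(\<Sum>x\<in>E. (cmod (l2_fun (schur u T (trunc F \<xi>)) x))\<^sup>2) \<le>
        (\<Sum>x\<in>F. (cmod (l2_fun (schur u T (trunc F \<xi>)) x))\<^sup>2)"
        using F by (intro sum_mono2) auto
      also have "\<dots> \<le> K\<^sup>2" using F \<xi> by (intro trunc_bound) auto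
      finally show "(\<Sum>x\<in>E. (cmod (l2_fun (schur u T (trunc F \<xi>)) x))\<^sup>2) \<le> K\<^sup>2" .
    qed (use E in auto)
    with lim show "(\<Sum>x\<in>E. (cmod (l2_fun (schur u T \<xi>) x))\<^sup>2) \<le> K\<^sup>2"
      by (rule tendsto_upperbound) simp
  qed
  show ?thesis
  proof (cases "\<xi> = 0")
    case True
    then show ?thesis using linear_0[OF bounded_linear.linear[OF BL2_bounded_linear[OF S]]] by simp
  next
    case False
    let ?r = "complex_of_real (1 / norm \<xi>)"
    have "norm (schur u T (?r *\<^sub>C \<xi>)) \<le> K"
      by (rule unit_bound) (use False in \<open>simp add: norm_scaleC norm_divide\<close>)
    then show ?thesis
      using False by (simp add: BL2_scaleC[OF S] norm_scaleC norm_divide K_def field_simps)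
  qed
qed

section \<open>From bounded entrywise convergence to weak* convergence\<close>

lemma cinner_trunc_trunc:
  assumes "A \<in> BL2"
  shows "cinner (A (trunc E \<xi>)) (trunc E \<eta>) =
    (\<Sum>x\<in>E. \<Sum>y\<in>E. l2_fun \<xi> x * (cnj (l2_fun \<eta> y) * l2_fun (A (ket x)) y))"
proof -
  have 1: "cinner \<zeta> (trunc E \<eta>) = (\<Sum>y\<in>E. cnj (l2_fun \<eta> y) * l2_fun \<zeta> y)" for \<zeta>
    by (simp add: trunc_def cinner_scaleC_right cinner_ket_right
        linear_sum[OF bounded_linear.linear[OF bounded_linear_cinner_right]])
  have "cinner (A (trunc E \<xi>)) (trunc E \<eta>) = (\<Sum>x\<in>E. l2_fun \<xi> x * cinner (A (ket x)) (trunc E \<eta>))"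
    by (simp only: BL2_trunc[OF assms] cinner_scaleC_left
        linear_sum[OF bounded_linear.linear[OF bounded_linear_cinner_left]])
  then show ?thesis by (simp only: 1 sum_distrib_left)
qed

text \<open>Both vectors are replaced by truncations, with an error that the common norm bound makes
  uniform in \<open>u\<close>. Between truncations only finitely many entries occur.\<close>

lemma weak_operator_limitI:
  assumes S: "\<forall>\<^sub>F u in U. S u \<in> BL2 \<and> (\<forall>\<xi>. norm (S u \<xi>) \<le> K * norm \<xi>)"
    and T: "T \<in> BL2" and entry: "\<And>x y. ((\<lambda>u. l2_fun (S u (ket x)) y) \<longlongrightarrow> l2_fun (T (ket x)) y) U"
  shows "((\<lambda>u. cinner (S u \<xi>) \<eta>) \<longlongrightarrow> cinner (T \<xi>) \<eta>) U"
proof (rule tendstoI)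
  fix e :: real assume e: "e > 0"
  \<comment> \<open>An upper bound for the truncation error of an operator with norm bound
    \<open>K\<close>; the absolute value is taken because no sign is assumed for \<open>K\<close>.
    One set \<open>E\<close> is then chosen to serve both for \<open>K\<close> and for
    \<open>onorm T\<close>.\<close>
  let ?g = "\<lambda>K E. \<bar>K\<bar> * (norm (\<xi> - trunc E \<xi>) * norm \<eta> + norm \<xi> * norm (\<eta> - trunc E \<eta>))"
  have "((\<lambda>E. ?g K E) \<longlongrightarrow> \<bar>K\<bar> * (norm (\<xi> - \<xi>) * norm \<eta> + norm \<xi> * norm (\<eta> - \<eta>)))
    (finite_subsets_at_top UNIV)" for K
    by (intro tendsto_intros trunc_tendsto)
  then have "\<forall>\<^sub>F E in finite_subsets_at_top UNIV. ?g K E < e / 3" for K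
    using e order_tendstoD(2)[of "?g K" 0 _ "e / 3"] by simp
  then have "\<forall>\<^sub>F E in finite_subsets_at_top UNIV. finite E \<and> ?g K E < e / 3 \<and> ?g (onorm T) E < e / 3"
    by (intro eventually_conj) (auto intro: eventually_finite_subsets_at_top_weakI)
  then obtain E where E: "finite E" "?g K E < e / 3" "?g (onorm T) E < e / 3"
    using eventually_happens finite_subsets_at_top_neq_bot by blast
  have approx: "cmod (cinner (A \<xi>) \<eta> - cinner (A (trunc E \<xi>)) (trunc E \<eta>)) \<le> ?g K E"
    if A: "A \<in> BL2" and K: "\<And>\<xi>. norm (A \<xi>) \<le> K * norm \<xi>" for A K
  proof -
    have K': "norm (A \<xi>) \<le> \<bar>K\<bar> * norm \<xi>" for \<xi>
      using K[of \<xi>] mult_right_mono[OF abs_ge_self[of K] norm_ge_zero[of \<xi>]] by linarith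
    have "cinner (A \<xi>) \<eta> - cinner (A (trunc E \<xi>)) (trunc E \<eta>) =
      cinner (A (\<xi> - trunc E \<xi>)) \<eta> + cinner (A (trunc E \<xi>)) (\<eta> - trunc E \<eta>)"
      by (simp add: BL2_diff[OF A] cinner_diff_left cinner_diff_right)
    moreover have "cmod (cinner (A (\<xi> - trunc E \<xi>)) \<eta>) \<le> \<bar>K\<bar> * norm (\<xi> - trunc E \<xi>) * norm \<eta>"
      by (rule order_trans[OF cinner_bound mult_right_mono[OF K']]) simp
    moreover have "cmod (cinner (A (trunc E \<xi>)) (\<eta> - trunc E \<eta>)) \<le> \<bar>K\<bar> * norm \<xi> * norm (\<eta> - trunc E \<eta>)"
    proof (rule order_trans[OF cinner_bound mult_right_mono])
      show "norm (A (trunc E \<xi>)) \<le> \<bar>K\<bar> * norm \<xi>"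
        by (rule order_trans[OF K' mult_left_mono[OF norm_trunc_le[OF E(1)]]]) simp
    qed simp
    ultimately show ?thesis
      using norm_triangle_ineq[of "cinner (A (\<xi> - trunc E \<xi>)) \<eta>"
          "cinner (A (trunc E \<xi>)) (\<eta> - trunc E \<eta>)"]
      by (simp add: distrib_left mult.assoc)
  qed
  have "((\<lambda>u. \<Sum>x\<in>E. \<Sum>y\<in>E. l2_fun \<xi> x * (cnj (l2_fun \<eta> y) * l2_fun (S u (ket x)) y)) \<longlongrightarrow>
    cinner (T (trunc E \<xi>)) (trunc E \<eta>)) U"
    unfolding cinner_trunc_trunc[OF T] by (intro tendsto_intros entry)
  then have "\<forall>\<^sub>F u in U. dist (\<Sum>x\<in>E. \<Sum>y\<in>E. l2_fun \<xi> x * (cnj (l2_fun \<eta> y) * l2_fun (S u (ket x)) y))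
    (cinner (T (trunc E \<xi>)) (trunc E \<eta>)) < e / 3"
    using e by (intro tendstoD) auto
  with S show "\<forall>\<^sub>F u in U. dist (cinner (S u \<xi>) \<eta>) (cinner (T \<xi>) \<eta>) < e"
  proof eventually_elim
    case (elim u)
    then have "cmod (cinner (S u (trunc E \<xi>)) (trunc E \<eta>) - cinner (T (trunc E \<xi>)) (trunc E \<eta>)) < e / 3"
      by (simp add: cinner_trunc_trunc dist_norm)
    moreover have "cmod (cinner (S u \<xi>) \<eta> - cinner (S u (trunc E \<xi>)) (trunc E \<eta>)) < e / 3"
      using approx[of "S u" K] elim E by fastforce
    moreover have "cmod (cinner (T \<xi>) \<eta> - cinner (T (trunc E \<xi>)) (trunc E \<eta>)) < e / 3"
      using approx[OF T BL2_norm_le[OF T]] E by fastforce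
    moreover have tri: "cmod (a - b) \<le> cmod (a - a') + cmod (a' - b') + cmod (b - b')" for a b a' b'
      using norm_triangle_ineq[of "a - a'" "a' - b'"] norm_triangle_ineq4[of "a - b'" "b - b'"] by simp
    ultimately show ?case
      using tri[of "cinner (S u \<xi>) \<eta>" "cinner (T \<xi>) \<eta>"
          "cinner (S u (trunc E \<xi>)) (trunc E \<eta>)" "cinner (T (trunc E \<xi>)) (trunc E \<eta>)"]
      unfolding dist_norm by linarith
  qed
qed

text \<open>Weak operator convergence handles each term of a representation of \<open>h\<close>, and
  the common norm bound supplies the domination for Tannery's theorem.\<close>

lemma weak_star_limitI:
  assumes U: "U \<noteq> bot"
    and S: "\<forall>\<^sub>F u in U. S u \<in> BL2 \<and> (\<forall>\<xi>. norm (S u \<xi>) \<le> K * norm \<xi>)"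
    and T: "T \<in> BL2" and entry: "\<And>x y. ((\<lambda>u. l2_fun (S u (ket x)) y) \<longlongrightarrow> l2_fun (T (ket x)) y) U"
    and h: "h \<in> trace_class"
  shows "((\<lambda>u. tpair (S u) h) \<longlongrightarrow> tpair T h) U"
proof -
  obtain f g where r: "represents f g h" using h by (auto simp: trace_class_def)
  have bound: "norm (cinner (S u (f i)) (l2_cnj (g i))) \<le> K * (norm (f i) * norm (g i))"
    if "\<forall>\<xi>. norm (S u \<xi>) \<le> K * norm \<xi>" for u i
  proof -
    have "norm (S u (f i)) * norm (l2_cnj (g i)) \<le> K * norm (f i) * norm (l2_cnj (g i))"
      using that by (intro mult_right_mono) auto
    with cinner_bound[of "S u (f i)" "l2_cnj (g i)"] show ?thesis
      by (simp add: norm_l2_cnj mult.assoc)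
  qed
  have "\<forall>\<^sub>F (i, u) in sequentially \<times>\<^sub>F U.
    norm (cinner (S u (f i)) (l2_cnj (g i))) \<le> K * (norm (f i) * norm (g i))"
    using eventually_prodI[OF always_eventually[of "\<lambda>_. True" sequentially] S]
    by (rule eventually_mono) (auto intro: bound)
  from tannerys_theorem[OF weak_operator_limitI[OF S T entry] this
      summable_mult[OF represents_summable_norm[OF r]] U]
  have "((\<lambda>u. \<Sum>i. cinner (S u (f i)) (l2_cnj (g i))) \<longlongrightarrow> tpair T h) U"
    by (simp add: tpair_eq[OF T r])
  then show ?thesis
    by (rule Lim_transform_eventually) (use S in eventually_elim, simp add: tpair_eq[OF _ r])
qed

section \<open>The annihilator is contained in the bimodule\<close>

lemma diagonal_L1_perp:
  fixes J :: "('g :: {countable, group_add} \<Rightarrow> complex) set"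
  assumes J: "J \<subseteq> L1" and T: "T \<in> annihilator (Ran J)"
  shows "diagonal T z \<in> L1_perp J"
proof -
  \<comment> \<open>The diagonal through \<open>z\<close> is the case \<open>s = 0\<close>,
    \<open>t = z\<close> of the criterion by entries.\<close>
  have "T \<in> BL2" and 0: "(\<Sum>\<^sub>\<infinity>r. f r * l2_fun (T (ket (z + r))) (0 + r)) = 0" if "f \<in> J" for f
    using T that unfolding annihilator_Ran_iff_entries[OF J] by blast+
  moreover have "T \<in> BL2" using T by (simp add: annihilator_def)
  ultimately show ?thesis
    by (simp add: L1_perp_def diagonal_Linfty) (simp add: diagonal_def mult.commute)
qed

text \<open>The operators \<open>schur u T\<close> lie in the span of the generators because the
  diagonals of \<open>T\<close> lie in \<open>L1_perp J\<close>. Weak amenability makes them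
  converge to \<open>T\<close> boundedly and entrywise, so \<open>T\<close> lies in the weak*
  closure.\<close>

lemma annihilator_subset_Bim:
  fixes J :: "('g :: {countable, group_add} \<Rightarrow> complex) set"
  assumes wa: "weakly_amenable TYPE('g)" and J: "J \<subseteq> L1"
  shows "annihilator (Ran J) \<subseteq> Bim (L1_perp J)"
proof
  fix T assume Tann: "T \<in> annihilator (Ran J)"
  then have T: "T \<in> BL2" by (simp add: annihilator_def)
  obtain U :: "('g \<Rightarrow> complex) filter" and L :: real where U: "U \<noteq> bot" and L: "L > 0"
    and ev: "\<forall>\<^sub>F u in U. u \<in> fourier_algebra \<and> finite {s. u s \<noteq> 0} \<and> mcb_norm u \<le> ennreal L"
    and lim: "\<And>s. ((\<lambda>u. u s) \<longlongrightarrow> 1) U"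
    using wa unfolding weakly_amenable_def by blast
  let ?A = "{A \<circ> mult_op a \<circ> B | A B a. A \<in> VN \<and> B \<in> VN \<and> a \<in> L1_perp J}"
  have lam_VN: "lam x \<in> VN" for x :: 'g
    using lam_in_VN[of 1 x] by (simp add: scaleC_simps)
  have gen: "?A \<subseteq> BL2"
    using VN_subset_BL2 by (auto intro!: BL2_compose BL2_mult_op simp: L1_perp_def)
  \<comment> \<open>This holds for every \<open>u\<close>: if the index set in \<open>schur\<close>
    is infinite, the sum is 0 and still lies in the span.\<close>
  have span: "schur u T \<in> op_span ?A" for u
    unfolding schur_def
    by (intro module.span_sum[OF module_operators] module.span_scale[OF module_operators]
        module.span_base[OF module_operators])
      (use lam_VN diagonal_L1_perp[OF J Tann] in blast)
  show "T \<in> Bim (L1_perp J)"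
    unfolding Bim_def
  proof (rule weak_star_closureI[OF T _ op_span_subset_BL2[OF gen] U])
    show "\<forall>\<^sub>F u in U. schur u T \<in> op_span ?A" using span by simp
    fix h :: "'g \<times> 'g \<Rightarrow> complex" assume h: "h \<in> trace_class"
    show "((\<lambda>u. tpair (schur u T) h) \<longlongrightarrow> tpair T h) U"
    proof (rule weak_star_limitI[OF U _ T _ h])
      show "\<forall>\<^sub>F u in U. schur u T \<in> BL2 \<and> (\<forall>\<xi>. norm (schur u T \<xi>) \<le> L * (onorm T + 1) * norm \<xi>)"
        using ev by eventually_elim (use norm_schur_le L T BL2_schur in blast)
      fix x y
      have "((\<lambda>u. u (y - x) * l2_fun (T (ket x)) y) \<longlongrightarrow> 1 * l2_fun (T (ket x)) y) U"
        by (intro tendsto_intros lim)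
      then have "((\<lambda>u. u (y - x) * l2_fun (T (ket x)) y) \<longlongrightarrow> l2_fun (T (ket x)) y) U" by simp
      then show "((\<lambda>u. l2_fun (schur u T (ket x)) y) \<longlongrightarrow> l2_fun (T (ket x)) y) U"
        by (rule Lim_transform_eventually) (use ev in eventually_elim, simp add: schur_entry T)
    qed
  qed
qed

theorem proposition5p3:
  fixes J :: "('g :: {countable, group_add} \<Rightarrow> complex) set"
  assumes "weakly_amenable TYPE('g)"
    and "closed_left_ideal J"
  shows "annihilator (Ran J) = Bim (L1_perp J)"
  using annihilator_subset_Bim[OF assms(1)] Bim_subset_annihilator[OF assms(2)] assms(2)
  unfolding closed_left_ideal_def by blast

end
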